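(* There exists a causally simple $3$-dimensional spacetime $(M,g)$ whose universal covering spacetime $(\tilde M,\tilde g)$ is such that the causal relation $\tilde J$ of $(\tilde M,\tilde g)$ is not closed in $\tilde M\times\tilde M$. Thus $(\tilde M,\tilde g)$ is not causally simple.
   Context: A spacetime $(M,g)$ is a connected, Hausdorff, second-countable $C^\infty$ manifold $M$ with a time-oriented $C^\infty$ Lorentzian metric $g$. The universal covering spacetime of $(M,g)$ is the universal covering manifold $\pi:\tilde M\to M$ endowed with $\tilde g=\pi^*g$ and the induced time-orientation. The causal relation of a spacetime $M$ is $J=\{(p,q)\in M\times M : q=p \text{ or there is a future-directed causal curve from } p \text{ to } q\}$. A spacetime is causal if it contains no closed causal curve. A spacetime is causally simple if it is causal and its causal relation $J$ is a closed subset of $M\times M$. *)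

theory Defs
  imports "HOL-Analysis.Analysis"
begin

section \<open>Smooth maps between Euclidean spaces\<close>

text \<open>Intended for open \<open>S\<close>: the derivatives are the full ones, at the points of \<open>S\<close>.\<close>

fun Ck_on :: "nat \<Rightarrow> 'e::euclidean_space set \<Rightarrow> ('e \<Rightarrow> 'f::real_normed_vector) \<Rightarrow> bool" where
  "Ck_on 0 S f \<longleftrightarrow> continuous_on S f"
| "Ck_on (Suc k) S f \<longleftrightarrow>
     (\<forall>x\<in>S. f differentiable (at x)) \<and>
     (\<forall>v. Ck_on k S (\<lambda>x. frechet_derivative f (at x) v))"

definition smooth_on :: "'e::euclidean_space set \<Rightarrow> ('e \<Rightarrow> 'f::real_normed_vector) \<Rightarrow> bool" where
  "smooth_on S f \<longleftrightarrow> (\<forall>k. Ck_on k S f)"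


section \<open>Smooth manifolds\<close>

text \<open>A chart is a pair of its domain and the coordinate map (whose values outside the domain are
  irrelevant). The model space \<open>'e\<close> fixes the dimension, \<open>DIM('e)\<close>. The smooth structure is given
  by an atlas, which need not be maximal.\<close>

type_synonym ('a, 'e) chart = "'a set \<times> ('a \<Rightarrow> 'e)"

record ('a, 'e) mfd =
  mtop :: "'a topology"
  atlas :: "('a, 'e) chart set"

abbreviation dom :: "('a, 'e) chart \<Rightarrow> 'a set" where
  "dom c \<equiv> fst c"

abbreviation coord :: "('a, 'e) chart \<Rightarrow> 'a \<Rightarrow> 'e" where
  "coord c \<equiv> snd c"

abbreviation param :: "('a, 'e) chart \<Rightarrow> 'e \<Rightarrow> 'a" where
  "param c \<equiv> inv_into (dom c) (coord c)"

definition is_chart :: "'a topology \<Rightarrow> ('a, 'e::euclidean_space) chart \<Rightarrow> bool" where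
  "is_chart X c \<longleftrightarrow>
     openin X (dom c) \<and> open (coord c ` dom c) \<and>
     homeomorphic_map (subtopology X (dom c)) (top_of_set (coord c ` dom c)) (coord c)"

definition smooth_manifold :: "('a, 'e::euclidean_space, 'z) mfd_scheme \<Rightarrow> bool" where
  "smooth_manifold M \<longleftrightarrow>
     Hausdorff_space (mtop M) \<and> second_countable (mtop M) \<and>
     (\<forall>c\<in>atlas M. is_chart (mtop M) c) \<and>
     (\<Union>c\<in>atlas M. dom c) = topspace (mtop M) \<and>
     (\<forall>c\<in>atlas M. \<forall>d\<in>atlas M. smooth_on (coord c ` (dom c \<inter> dom d)) (coord d \<circ> param c))"

definition smooth_map ::
  "('a, 'e::euclidean_space, 'y) mfd_scheme \<Rightarrow> 'a set \<Rightarrow>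
   ('b, 'f::euclidean_space, 'z) mfd_scheme \<Rightarrow> ('a \<Rightarrow> 'b) \<Rightarrow> bool" where
  "smooth_map M W N f \<longleftrightarrow>
     openin (mtop M) W \<and> continuous_map (subtopology (mtop M) W) (mtop N) f \<and>
     (\<forall>c\<in>atlas M. \<forall>d\<in>atlas N.
        smooth_on (coord c ` (dom c \<inter> W \<inter> f -` dom d)) (coord d \<circ> f \<circ> param c))"

text \<open>The differential of \<open>f\<close> at \<open>p\<close>, expressed in the chart \<open>c\<close> around \<open>p\<close> and the chart \<open>d\<close> around
  \<open>f p\<close>. For \<open>f = id\<close> it is the change of components of tangent vectors from \<open>c\<close> to \<open>d\<close>.\<close>

definition differential ::
  "('a, 'e::euclidean_space) chart \<Rightarrow> ('b, 'f::euclidean_space) chart \<Rightarrow> ('a \<Rightarrow> 'b) \<Rightarrow> 'a \<Rightarrow> 'e \<Rightarrow> 'f"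
  where
  "differential c d f p = frechet_derivative (coord d \<circ> f \<circ> param c) (at (coord c p))"


section \<open>Spacetimes\<close>

text \<open>Tensor fields are given by their components: \<open>metric M c p u v\<close> is the value of \<open>g\<^sub>p\<close> on the
  tangent vectors at \<open>p\<close> whose components in the chart \<open>c\<close> are \<open>u\<close> and \<open>v\<close>, and \<open>tfield M c p\<close> are the
  components of the vector field that fixes the time orientation. Only \<open>c \<in> atlas M\<close> and \<open>p \<in> dom c\<close>
  matter.\<close>

record ('a, 'e) lorentz_mfd = "('a, 'e) mfd" +
  metric :: "('a, 'e) chart \<Rightarrow> 'a \<Rightarrow> 'e \<Rightarrow> 'e \<Rightarrow> real"
  tfield :: "('a, 'e) chart \<Rightarrow> 'a \<Rightarrow> 'e"

text \<open>Symmetric bilinear form of signature \<open>(-,+,\<dots>,+)\<close>: there is an orthonormal basis with exactly one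
  timelike member.\<close>

definition lorentz_form :: "('e::euclidean_space \<Rightarrow> 'e \<Rightarrow> real) \<Rightarrow> bool" where
  "lorentz_form g \<longleftrightarrow>
     bilinear g \<and> (\<forall>u v. g u v = g v u) \<and>
     (\<exists>B e\<^sub>0. independent B \<and> span B = UNIV \<and> e\<^sub>0 \<in> B \<and> g e\<^sub>0 e\<^sub>0 = -1 \<and>
        (\<forall>e\<in>B - {e\<^sub>0}. g e e = 1) \<and> (\<forall>e\<in>B. \<forall>f\<in>B. e \<noteq> f \<longrightarrow> g e f = 0))"

definition lorentz_metric :: "('a, 'e::euclidean_space) lorentz_mfd \<Rightarrow> bool" where
  "lorentz_metric M \<longleftrightarrow>
     (\<forall>c\<in>atlas M. \<forall>p\<in>dom c. lorentz_form (metric M c p)) \<and>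
     (\<forall>c\<in>atlas M. \<forall>u v. smooth_on (coord c ` dom c) (\<lambda>x. metric M c (param c x) u v)) \<and>
     (\<forall>c\<in>atlas M. \<forall>d\<in>atlas M. \<forall>p\<in>dom c \<inter> dom d. \<forall>u v.
        metric M c p u v = metric M d p (differential c d id p u) (differential c d id p v))"

text \<open>The time orientation is represented by a continuous timelike vector field; fields that select
  the same \<open>future_directed\<close> vectors represent the same time orientation.\<close>

definition time_orienting :: "('a, 'e::euclidean_space) lorentz_mfd \<Rightarrow> bool" where
  "time_orienting M \<longleftrightarrow>
     (\<forall>c\<in>atlas M. continuous_map (subtopology (mtop M) (dom c)) euclidean (tfield M c)) \<and>
     (\<forall>c\<in>atlas M. \<forall>p\<in>dom c. metric M c p (tfield M c p) (tfield M c p) < 0) \<and>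
     (\<forall>c\<in>atlas M. \<forall>d\<in>atlas M. \<forall>p\<in>dom c \<inter> dom d.
        tfield M d p = differential c d id p (tfield M c p))"

definition spacetime :: "('a, 'e::euclidean_space) lorentz_mfd \<Rightarrow> bool" where
  "spacetime M \<longleftrightarrow>
     smooth_manifold M \<and> topspace (mtop M) \<noteq> {} \<and> connected_space (mtop M) \<and>
     lorentz_metric M \<and> time_orienting M"


section \<open>Causality\<close>

definition causal_vector ::
  "('a, 'e::euclidean_space) lorentz_mfd \<Rightarrow> ('a, 'e) chart \<Rightarrow> 'a \<Rightarrow> 'e \<Rightarrow> bool" where
  "causal_vector M c p v \<longleftrightarrow> v \<noteq> 0 \<and> metric M c p v v \<le> 0"

definition future_directed ::
  "('a, 'e::euclidean_space) lorentz_mfd \<Rightarrow> ('a, 'e) chart \<Rightarrow> 'a \<Rightarrow> 'e \<Rightarrow> bool" where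
  "future_directed M c p v \<longleftrightarrow> causal_vector M c p v \<and> metric M c p (tfield M c p) v < 0"

text \<open>Future-directed causal curves are piecewise \<open>C\<^sup>1\<close>: on each closed piece, \<open>w\<close> is the (at the end
  points one-sided) velocity in the chart \<open>c\<close>.\<close>

definition causal_C1_segment ::
  "('a, 'e::euclidean_space) lorentz_mfd \<Rightarrow> (real \<Rightarrow> 'a) \<Rightarrow> real \<Rightarrow> real \<Rightarrow> bool" where
  "causal_C1_segment M \<gamma> a b \<longleftrightarrow>
     a < b \<and> continuous_map (top_of_set {a..b}) (mtop M) \<gamma> \<and>
     (\<forall>c\<in>atlas M. \<exists>w. continuous_on {s\<in>{a..b}. \<gamma> s \<in> dom c} w \<and>
        (\<forall>s\<in>{a..b}. \<gamma> s \<in> dom c \<longrightarrow>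
           ((coord c \<circ> \<gamma>) has_vector_derivative w s) (at s within {a..b}) \<and>
           future_directed M c (\<gamma> s) (w s)))"

definition causal_curve ::
  "('a, 'e::euclidean_space) lorentz_mfd \<Rightarrow> (real \<Rightarrow> 'a) \<Rightarrow> real \<Rightarrow> real \<Rightarrow> bool" where
  "causal_curve M \<gamma> a b \<longleftrightarrow>
     (\<exists>n t. 0 < (n::nat) \<and> t 0 = a \<and> t n = b \<and> (\<forall>i<n. causal_C1_segment M \<gamma> (t i) (t (Suc i))))"

definition causal_relation :: "('a, 'e::euclidean_space) lorentz_mfd \<Rightarrow> ('a \<times> 'a) set" where
  "causal_relation M =
     {(p, q). p \<in> topspace (mtop M) \<and> q \<in> topspace (mtop M) \<and>
        (q = p \<or> (\<exists>\<gamma> a b. causal_curve M \<gamma> a b \<and> \<gamma> a = p \<and> \<gamma> b = q))}"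

definition closed_causal_relation :: "('a, 'e::euclidean_space) lorentz_mfd \<Rightarrow> bool" where
  "closed_causal_relation M \<longleftrightarrow> closedin (prod_topology (mtop M) (mtop M)) (causal_relation M)"

definition causal :: "('a, 'e::euclidean_space) lorentz_mfd \<Rightarrow> bool" where
  "causal M \<longleftrightarrow> \<not> (\<exists>\<gamma> a b. causal_curve M \<gamma> a b \<and> \<gamma> a = \<gamma> b)"

definition causally_simple :: "('a, 'e::euclidean_space) lorentz_mfd \<Rightarrow> bool" where
  "causally_simple M \<longleftrightarrow> causal M \<and> closed_causal_relation M"


section \<open>Universal covering spacetimes\<close>

text \<open>The library's \<open>simply_connected\<close> and \<open>covering_space\<close> are about subsets of a topological space
  type; these are the versions for abstract topologies.\<close>

definition simply_connected_space :: "'a topology \<Rightarrow> bool" where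
  "simply_connected_space X \<longleftrightarrow>
     path_connected_space X \<and>
     (\<forall>\<gamma> p. pathin X \<gamma> \<and> \<gamma> 0 = p \<and> \<gamma> 1 = p \<longrightarrow>
        homotopic_with (\<lambda>h. h 0 = p \<and> h 1 = p) (top_of_set {0..1}) X \<gamma> (\<lambda>_. p))"

text \<open>Every point of the base has a neighbourhood whose preimage is a disjoint union of open sets
  that \<open>\<pi>\<close> maps diffeomorphically onto it.\<close>

definition smooth_covering ::
  "('a, 'e::euclidean_space, 'y) mfd_scheme \<Rightarrow> ('a \<Rightarrow> 'b) \<Rightarrow>
   ('b, 'f::euclidean_space, 'z) mfd_scheme \<Rightarrow> bool" where
  "smooth_covering N \<pi> M \<longleftrightarrow>
     smooth_map N (topspace (mtop N)) M \<pi> \<and>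
     \<pi> ` topspace (mtop N) = topspace (mtop M) \<and>
     (\<forall>p\<in>topspace (mtop M). \<exists>U \<V>. p \<in> U \<and> openin (mtop M) U \<and>
        disjoint \<V> \<and> \<Union>\<V> = {x \<in> topspace (mtop N). \<pi> x \<in> U} \<and>
        (\<forall>V\<in>\<V>. openin (mtop N) V \<and> bij_betw \<pi> V U \<and> smooth_map M U N (inv_into V \<pi>)))"

definition universal_covering ::
  "('a, 'e::euclidean_space, 'y) mfd_scheme \<Rightarrow> ('a \<Rightarrow> 'b) \<Rightarrow>
   ('b, 'f::euclidean_space, 'z) mfd_scheme \<Rightarrow> bool" where
  "universal_covering N \<pi> M \<longleftrightarrow>
     smooth_manifold N \<and> simply_connected_space (mtop N) \<and> smooth_covering N \<pi> M"

text \<open>\<open>N\<close> carries the pullback metric \<open>\<pi>\<^sup>*g\<close> and the time orientation induced by \<open>\<pi>\<close>.\<close>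

definition universal_covering_spacetime ::
  "('a, 'e::euclidean_space) lorentz_mfd \<Rightarrow> ('a \<Rightarrow> 'b) \<Rightarrow>
   ('b, 'f::euclidean_space) lorentz_mfd \<Rightarrow> bool" where
  "universal_covering_spacetime N \<pi> M \<longleftrightarrow>
     spacetime N \<and> universal_covering N \<pi> M \<and>
     (\<forall>c\<in>atlas N. \<forall>d\<in>atlas M. \<forall>p\<in>dom c. \<pi> p \<in> dom d \<longrightarrow>
        (\<forall>u v. metric N c p u v =
           metric M d (\<pi> p) (differential c d \<pi> p u) (differential c d \<pi> p v)) \<and>
        (\<forall>v. future_directed N c p v \<longleftrightarrow>
           future_directed M d (\<pi> p) (differential c d \<pi> p v)))"

end

theory Submission
  imports Defs
begin

text \<open>
  A static spacetime \<open>\<real> \<times> S\<close> with metric \<open>-dt\<^sup>2 + h\<close> has a closed causal relation as soon as any two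
  points of the Riemannian manifold \<open>(S, h)\<close> are joined by a curve of minimal length, because then
  \<open>(t, x)\<close> precedes \<open>(t', x')\<close> iff \<open>t' - t\<close> is at least the distance of \<open>x\<close> and \<open>x'\<close>; and it
  is not closed if some pair at finite distance has no such curve. So it suffices to find a surface
  that is geodesically convex in this sense although its universal cover is not.

  A flat cone of angle \<open>\<pi>\<close> without its apex is such a surface. It is \<open>\<complex> - {0}\<close> modulo \<open>z \<mapsto> -z\<close>. Of the
  two straight segments from \<open>z\<close> to \<open>z'\<close> and to \<open>-z'\<close>, the shorter one never meets the origin, so
  it gives a shortest curve on the cone. In the universal cover, however, polar angles range over all of
  \<open>\<real>\<close>, and two points at radius \<open>1\<close> whose angles differ by \<open>\<pi>\<close> have distance \<open>2\<close>, which only the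
  broken line through the missing apex could attain.

  In the coordinate \<open>w = z\<^sup>2\<close> the flat metric \<open>|dz|\<^sup>2\<close> reads \<open>|dw|\<^sup>2 / (4 |w|)\<close> on \<open>\<complex> - {0}\<close>, and with
  \<open>w = exp \<zeta>\<close> its pullback to the universal cover \<open>\<complex>\<close> is \<open>exp (Re \<zeta>) |d\<zeta>|\<^sup>2 / 4\<close>. Hence both
  \<open>cone_spacetime\<close> and \<open>unrolled_spacetime\<close> have an atlas with one chart, and the covering map is
  \<open>(t, \<zeta>) \<mapsto> (t, exp \<zeta>)\<close>.

  The estimate behind everything is \<open>square_root_bound\<close>: along a causal curve the flat coordinate
  \<open>z = exp (\<zeta> / 2)\<close> moves at most as far as time advances. On the cone it shows that causally related
  points have square roots at distance at most \<open>t' - t\<close>; straight segments in \<open>z\<close> give the converse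
  (\<open>causal_relation_cone\<close>), and the resulting condition combines weak inequalities between
  continuous functions by conjunction and disjunction (\<open>square_root_related_polynomial\<close>), hence is closed. On the cover it shows that a causal curve
  of duration \<open>2\<close> between the two exceptional points would have to pass through \<open>z = 0\<close>
  (\<open>unrolled_not_related_pi\<close>), while points of smaller angle are related
  (\<open>unrolled_related_below_pi\<close>).
\<close>

section \<open>Calculus of smooth maps\<close>

lemma Ck_on_cong:
  assumes "open S" "\<And>x. x \<in> S \<Longrightarrow> f x = g x"
  shows "Ck_on k S f \<longleftrightarrow> Ck_on k S g"
proof -
  have "Ck_on k S g" if "Ck_on k S f" "\<And>x. x \<in> S \<Longrightarrow> f x = g x" for f g :: "'a \<Rightarrow> 'b"
    using that
  proof (induction k arbitrary: f g)
    case 0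
    then show ?case using continuous_on_cong[of S S f g] by simp
  next
    case (Suc k)
    have d: "f differentiable (at x)" if "x \<in> S" for x
      using Suc.prems(1) that by simp
    have "g differentiable (at x)" if "x \<in> S" for x
      using d[OF that] Suc.prems(2) \<open>open S\<close> that unfolding differentiable_def
      by (metis has_derivative_transform_within_open)
    moreover have "Ck_on k S (\<lambda>x. frechet_derivative g (at x) v)" for v
    proof (rule Suc.IH)
      show "Ck_on k S (\<lambda>x. frechet_derivative f (at x) v)"
        using Suc.prems(1) by simp
      show "frechet_derivative f (at x) v = frechet_derivative g (at x) v" if "x \<in> S" for x
        using frechet_derivative_transform_within_open[OF d[OF that] \<open>open S\<close> that] Suc.prems(2)
        by metis
    qed
    ultimately show ?case by simp
  qed
  from this[of f g] this[of g f] show ?thesis using assms(2) by auto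
qed

text \<open>Together with the next lemma this replaces \<open>frechet_derivative\<close> by derivatives given explicitly,
  to which the usual differentiation rules apply.\<close>

lemma Ck_on_SucI:
  assumes "open S" "\<And>x. x \<in> S \<Longrightarrow> (f has_derivative f' x) (at x)"
    and "\<And>v. Ck_on k S (\<lambda>x. f' x v)"
  shows "Ck_on (Suc k) S f"
proof -
  have "Ck_on k S (\<lambda>x. frechet_derivative f (at x) v)" for v
    using assms(3)[of v] Ck_on_cong[OF assms(1), of "\<lambda>x. frechet_derivative f (at x) v"]
    by (metis assms(2) frechet_derivative_at)
  then show ?thesis
    using assms(2) by (auto simp: differentiable_def)
qed

lemma Ck_on_SucE:
  assumes "Ck_on (Suc k) S f"
  obtains f' where "\<And>x. x \<in> S \<Longrightarrow> (f has_derivative f' x) (at x)" "\<And>v. Ck_on k S (\<lambda>x. f' x v)"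
  using assms that[of "\<lambda>x. frechet_derivative f (at x)"]
  by (auto simp: frechet_derivative_works[symmetric])

lemma Ck_on_mono: "Ck_on (Suc k) S f \<Longrightarrow> Ck_on k S f"
proof (induction k arbitrary: f)
  case 0
  then show ?case
    by (auto intro!: continuous_at_imp_continuous_on differentiable_imp_continuous_within)
next
  case (Suc k)
  then show ?case by simp
qed

declare Ck_on.simps(2) [simp del]

lemma Ck_on_const: "open S \<Longrightarrow> Ck_on k S (\<lambda>_. c)"
proof (induction k arbitrary: c)
  case (Suc k)
  show ?case
    by (rule Ck_on_SucI[OF Suc.prems, where f' = "\<lambda>_ _. 0"]) (use Suc in auto)
qed simp

lemma Ck_on_linear:
  assumes "open S" "bounded_linear L"
  shows "Ck_on k S L"
proof (cases k)
  case 0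
  then show ?thesis using assms(2) by (simp add: linear_continuous_on)
next
  case (Suc j)
  have "(L has_derivative L) (at x)" for x
    using assms(2) bounded_linear_imp_has_derivative by blast
  then show ?thesis
    unfolding Suc using assms(1) by (auto intro!: Ck_on_SucI[where f' = "\<lambda>_. L"] Ck_on_const)
qed

lemma Ck_on_linear_comp:
  assumes "open S" "bounded_linear L" "Ck_on k S f"
  shows "Ck_on k S (\<lambda>x. L (f x))"
  using assms(3)
proof (induction k arbitrary: f)
  case 0
  then show ?case using assms(2) by (simp add: bounded_linear.continuous_on)
next
  case (Suc k)
  obtain f' where f': "\<And>x. x \<in> S \<Longrightarrow> (f has_derivative f' x) (at x)" "\<And>v. Ck_on k S (\<lambda>x. f' x v)"
    using Ck_on_SucE[OF Suc.prems] by metis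
  show ?case
    by (rule Ck_on_SucI[OF assms(1) bounded_linear.has_derivative[OF assms(2) f'(1)]])
      (use Suc.IH f'(2) in auto)
qed

lemma Ck_on_add:
  assumes "open S" "Ck_on k S f" "Ck_on k S g"
  shows "Ck_on k S (\<lambda>x. f x + g x)"
  using assms(2,3)
proof (induction k arbitrary: f g)
  case 0
  then show ?case by (simp add: continuous_on_add)
next
  case (Suc k)
  obtain f' where f': "\<And>x. x \<in> S \<Longrightarrow> (f has_derivative f' x) (at x)" "\<And>v. Ck_on k S (\<lambda>x. f' x v)"
    using Ck_on_SucE[OF Suc.prems(1)] by metis
  obtain g' where g': "\<And>x. x \<in> S \<Longrightarrow> (g has_derivative g' x) (at x)" "\<And>v. Ck_on k S (\<lambda>x. g' x v)"
    using Ck_on_SucE[OF Suc.prems(2)] by metis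
  show ?case
    by (rule Ck_on_SucI[OF assms(1) has_derivative_add[OF f'(1) g'(1)]])
      (use Suc.IH f'(2) g'(2) in auto)
qed

lemma Ck_on_bilinear:
  assumes "open S" "bounded_bilinear mul" "Ck_on k S f" "Ck_on k S g"
  shows "Ck_on k S (\<lambda>x. mul (f x) (g x))"
  using assms(3,4)
proof (induction k arbitrary: f g)
  case 0
  then show ?case using assms(2) by (simp add: bounded_bilinear.continuous_on)
next
  case (Suc k)
  obtain f' where f': "\<And>x. x \<in> S \<Longrightarrow> (f has_derivative f' x) (at x)" "\<And>v. Ck_on k S (\<lambda>x. f' x v)"
    using Ck_on_SucE[OF Suc.prems(1)] by metis
  obtain g' where g': "\<And>x. x \<in> S \<Longrightarrow> (g has_derivative g' x) (at x)" "\<And>v. Ck_on k S (\<lambda>x. g' x v)"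
    using Ck_on_SucE[OF Suc.prems(2)] by metis
  show ?case
    by (rule Ck_on_SucI[OF assms(1) bounded_bilinear.FDERIV[OF assms(2) f'(1) g'(1)]])
      (auto intro!: Ck_on_add assms(1) Suc.IH f'(2) g'(2) Ck_on_mono[OF Suc.prems(1)]
        Ck_on_mono[OF Suc.prems(2)])
qed

text \<open>Smoothness of \<open>exp \<circ> f\<close>, \<open>inverse \<circ> f\<close> and so on follows from this chain rule by induction on the
  order, because the derivative of the outer function is again expressed through functions of the
  same kind, at one order less.\<close>

lemma Ck_on_chain:
  fixes \<phi> \<phi>' :: "'f::real_normed_field \<Rightarrow> 'f"
  assumes "open S" "\<And>x. x \<in> S \<Longrightarrow> (\<phi> has_field_derivative \<phi>' (f x)) (at (f x))"
    and "Ck_on k S (\<lambda>x. \<phi>' (f x))" "Ck_on (Suc k) S f"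
  shows "Ck_on (Suc k) S (\<lambda>x. \<phi> (f x))"
proof -
  obtain f' where f': "\<And>x. x \<in> S \<Longrightarrow> (f has_derivative f' x) (at x)" "\<And>v. Ck_on k S (\<lambda>x. f' x v)"
    using Ck_on_SucE[OF assms(4)] by metis
  show ?thesis
  proof (rule Ck_on_SucI[OF assms(1)])
    show "((\<lambda>x. \<phi> (f x)) has_derivative (\<lambda>h. \<phi>' (f x) * f' x h)) (at x)" if "x \<in> S" for x
      using has_derivative_compose[OF f'(1)[OF that] has_field_derivative_imp_has_derivative[OF assms(2)[OF that]]]
      by simp
    show "Ck_on k S (\<lambda>x. \<phi>' (f x) * f' x v)" for v
      by (intro Ck_on_bilinear[OF _ bounded_bilinear_mult] assms f')
  qed
qed

lemma Ck_on_exp: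
  fixes f :: "_ \<Rightarrow> 'f::{real_normed_field,banach}"
  assumes "open S" "Ck_on k S f"
  shows "Ck_on k S (\<lambda>x. exp (f x))"
  using assms(2)
proof (induction k)
  case 0
  then show ?case by (simp add: continuous_on_exp)
next
  case (Suc k)
  show ?case
    by (rule Ck_on_chain[OF assms(1) _ _ Suc.prems, of exp exp])
      (use Suc Ck_on_mono in \<open>auto intro!: derivative_eq_intros\<close>)
qed

lemma Ck_on_inverse:
  fixes f :: "_ \<Rightarrow> 'f::real_normed_field"
  assumes "open S" "Ck_on k S f" "\<And>x. x \<in> S \<Longrightarrow> f x \<noteq> 0"
  shows "Ck_on k S (\<lambda>x. inverse (f x))"
  using assms(2)
proof (induction k)
  case 0
  then show ?case using assms(3) by (simp add: continuous_on_inverse)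
next
  case (Suc k)
  have k: "Ck_on k S (\<lambda>x. inverse (f x))"
    using Suc Ck_on_mono by blast
  have "Ck_on k S (\<lambda>x. - (inverse (f x) * inverse (f x)))"
    by (intro Ck_on_linear_comp[OF _ bounded_linear_minus[OF bounded_linear_ident]]
        Ck_on_bilinear[OF _ bounded_bilinear_mult] k assms)
  moreover have "(inverse has_field_derivative - (inverse z * inverse z)) (at z)" if "z \<noteq> 0" for z :: 'f
    using DERIV_inverse[OF that] by (simp add: power2_eq_square power_inverse)
  ultimately show ?case
    using Ck_on_chain[OF assms(1) _ _ Suc.prems, of inverse "\<lambda>z. - (inverse z * inverse z)"] assms(3)
    by auto
qed

lemma Ck_on_Ln:
  assumes "open S" "Ck_on k S f" "\<And>x. x \<in> S \<Longrightarrow> f x \<notin> \<real>\<^sub>\<le>\<^sub>0"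
  shows "Ck_on k S (\<lambda>x. Ln (f x))"
proof (cases k)
  case 0
  then show ?thesis using assms by (auto intro!: continuous_on_Ln')
next
  case (Suc j)
  have "f x \<noteq> 0" if "x \<in> S" for x
    using assms(3)[OF that] by auto
  then have "Ck_on j S (\<lambda>x. inverse (f x))"
    using Ck_on_inverse Ck_on_mono assms Suc by metis
  then show ?thesis
    unfolding Suc using Ck_on_chain[OF assms(1), of Ln inverse f j] assms Suc
    using has_field_derivative_Ln by blast
qed

lemma Ck_on_norm:
  fixes f :: "_ \<Rightarrow> 'f::real_inner"
  assumes "open S" "Ck_on k S f" "\<And>x. x \<in> S \<Longrightarrow> f x \<noteq> 0"
  shows "Ck_on k S (\<lambda>x. norm (f x))"
  using assms(2)
proof (induction k)
  case 0
  then show ?case by (simp add: continuous_on_norm)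
next
  case (Suc k)
  obtain f' where f': "\<And>x. x \<in> S \<Longrightarrow> (f has_derivative f' x) (at x)" "\<And>v. Ck_on k S (\<lambda>x. f' x v)"
    using Ck_on_SucE[OF Suc.prems] by metis
  show ?case
  proof (rule Ck_on_SucI[OF assms(1)])
    show "((\<lambda>x. norm (f x)) has_derivative (\<lambda>h. inverse (norm (f x)) * (f x \<bullet> f' x h))) (at x)"
      if "x \<in> S" for x
      using has_derivative_compose[OF f'(1)[OF that] has_derivative_norm[OF assms(3)[OF that]]]
      by (simp add: sgn_div_norm inner_commute)
    show "Ck_on k S (\<lambda>x. inverse (norm (f x)) * (f x \<bullet> f' x v))" for v
      by (intro Ck_on_bilinear[OF _ bounded_bilinear_mult] Ck_on_bilinear[OF _ bounded_bilinear_inner]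
          Ck_on_inverse assms f' Suc.IH Ck_on_mono[OF Suc.prems]) (use assms(3) in auto)
  qed
qed

section \<open>Spacetimes with isothermal spatial coordinates\<close>

abbreviation spatial :: "real^3 \<Rightarrow> complex" where
  "spatial p \<equiv> Complex (p $ 2) (p $ 3)"

definition event :: "real \<Rightarrow> complex \<Rightarrow> real^3" where
  "event t z = vector [t, Re z, Im z]"

lemma event_nth [simp]: "event t z $ 1 = t" "event t z $ 2 = Re z" "event t z $ 3 = Im z"
  by (auto simp: event_def)

lemma event_eqI: "p $ 1 = q $ 1 \<Longrightarrow> spatial p = spatial q \<Longrightarrow> p = q"
  by (simp add: vec_eq_iff forall_3)

lemma event_collapse [simp]: "event (p $ 1) (spatial p) = p"
  by (rule event_eqI; simp)

lemma event_split:
  "event t z = t *\<^sub>R axis 1 1 + (Re z *\<^sub>R axis 2 1 + Im z *\<^sub>R axis 3 1)"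
  by (simp add: vec_eq_iff forall_3 axis_def)

lemma bounded_linear_spatial: "bounded_linear spatial"
  unfolding Complex_eq
  by (intro bounded_linear_add bounded_linear_const_mult bounded_linear_of_real
      bounded_linear_compose[OF bounded_linear_of_real] bounded_linear_vec_nth)

lemma bounded_linear_event: "bounded_linear (\<lambda>(t, z). event t z)"
  unfolding event_split case_prod_unfold
  by (intro bounded_linear_add bounded_linear_compose[OF bounded_linear_scaleR_left]
      bounded_linear_compose[OF bounded_linear_Re] bounded_linear_compose[OF bounded_linear_Im]
      bounded_linear_fst bounded_linear_snd)

lemmas continuous_on_spatial [continuous_intros] =
  bounded_linear.continuous_on[OF bounded_linear_spatial]

lemma continuous_on_event [continuous_intros]:
  "continuous_on S f \<Longrightarrow> continuous_on S g \<Longrightarrow> continuous_on S (\<lambda>x. event (f x) (g x))"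
  using bounded_linear.continuous_on[OF bounded_linear_event continuous_on_Pair] by simp

lemmas has_vector_derivative_spatial = bounded_linear.has_vector_derivative[OF bounded_linear_spatial]
lemmas has_vector_derivative_nth = bounded_linear.has_vector_derivative[OF bounded_linear_vec_nth]

lemma has_vector_derivative_event:
  assumes "(f has_vector_derivative f') (at s within A)" "(g has_vector_derivative g') (at s within A)"
  shows "((\<lambda>x. event (f x) (g x)) has_vector_derivative event f' g') (at s within A)"
  using bounded_linear.has_vector_derivative[OF bounded_linear_event has_vector_derivative_Pair[OF assms]]
  by simp

lemma Ck_on_event:
  assumes "open S" "Ck_on k S f" "Ck_on k S g"
  shows "Ck_on k S (\<lambda>x. event (f x) (g x))"
  unfolding event_split
  by (intro Ck_on_add[OF assms(1)] Ck_on_linear_comp[OF assms(1), where L = "\<lambda>t. t *\<^sub>R axis _ _"]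
      bounded_linear_scaleR_left assms Ck_on_linear_comp[OF assms(1) bounded_linear_Re]
      Ck_on_linear_comp[OF assms(1) bounded_linear_Im])

text \<open>This is the metric \<open>-dt\<^sup>2 + \<rho> |dz|\<^sup>2\<close>, for which \<open>Re z\<close> and \<open>Im z\<close> are isothermal coordinates of
  the spatial slices.\<close>

definition isothermal_spacetime :: "(real^3) set \<Rightarrow> (real^3 \<Rightarrow> real) \<Rightarrow> (real^3, real^3) lorentz_mfd" where
  "isothermal_spacetime S \<rho> =
     \<lparr>mtop = top_of_set S, atlas = {(S, id)},
      metric = \<lambda>_ p u v. - (u $ 1) * v $ 1 + \<rho> p * (spatial u \<bullet> spatial v),
      tfield = \<lambda>_ _. axis 1 1\<rparr>"

lemma isothermal_spacetime_simps [simp]: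
  "mtop (isothermal_spacetime S \<rho>) = top_of_set S"
  "atlas (isothermal_spacetime S \<rho>) = {(S, id)}"
  "metric (isothermal_spacetime S \<rho>) c p = (\<lambda>u v. - (u $ 1) * v $ 1 + \<rho> p * (spatial u \<bullet> spatial v))"
  "tfield (isothermal_spacetime S \<rho>) c = (\<lambda>_. axis 1 1)"
  by (simp_all add: isothermal_spacetime_def)

lemma future_directed_isothermal:
  assumes "\<rho> p > 0"
  shows "future_directed (isothermal_spacetime S \<rho>) c p v \<longleftrightarrow>
    v $ 1 > 0 \<and> \<rho> p * (norm (spatial v))\<^sup>2 \<le> (v $ 1)\<^sup>2"
proof -
  have "v $ 1 \<noteq> 0 \<Longrightarrow> v \<noteq> 0"
    by auto
  then show ?thesis
    unfolding future_directed_def causal_vector_def power2_norm_eq_inner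
    by (auto simp: power2_eq_square axis_def inner_complex_def)
qed

lemma lorentz_form_isothermal:
  assumes "r > 0"
  shows "lorentz_form (\<lambda>u v. - (u $ 1) * v $ 1 + r * (spatial u \<bullet> spatial v))"
proof -
  let ?g = "\<lambda>u v :: real^3. - (u $ 1) * v $ 1 + r * (spatial u \<bullet> spatial v)"
  define e1 e2 e3 :: "real^3" where "e1 = event 1 0" and "e2 = event 0 (Complex (1 / sqrt r) 0)"
    and "e3 = event 0 (Complex 0 (1 / sqrt r))"
  note e = e1_def e2_def e3_def
  have B: "x = x $ 1 *\<^sub>R e1 + (sqrt r * x $ 2) *\<^sub>R e2 + (sqrt r * x $ 3) *\<^sub>R e3" for x
    using assms by (simp add: vec_eq_iff forall_3 e)
  have span: "span {e1, e2, e3} = UNIV"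
  proof -
    have "x \<in> span {e1, e2, e3}" for x
      by (subst B) (intro span_add span_scale span_base; simp)
    then show ?thesis by auto
  qed
  have neq: "e1 \<noteq> e2" "e1 \<noteq> e3" "e2 \<noteq> e3"
    using assms by (auto simp: vec_eq_iff forall_3 e)
  have "independent {e1, e2, e3}"
    using neq span by (intro card_le_dim_spanning[of _ UNIV]) simp_all
  moreover have "bilinear ?g"
    unfolding bilinear_def
    by (intro conjI allI linearI) (simp_all add: algebra_simps inner_complex_def)
  ultimately show ?thesis
    unfolding lorentz_form_def using assms span neq
    by (intro conjI exI[of _ "{e1, e2, e3}"] exI[of _ e1]) (auto simp: e inner_complex_def power2_eq_square[symmetric] power_divide)
qed

text \<open>The explicit argument is needed because \<open>inv_into S id\<close> is the identity only on \<open>S\<close>; since \<open>S\<close> is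
  open, this does not affect derivatives at its points.\<close>

lemma differential_id:
  assumes "open S" "p \<in> S" "f differentiable (at p)"
  shows "differential (S, id) (T, id) f p = frechet_derivative f (at p)"
proof -
  have "frechet_derivative f (at p) = frechet_derivative (id \<circ> f \<circ> inv_into S id) (at p)"
    using assms by (intro frechet_derivative_transform_within_open[of _ _ S])
      (auto simp: inv_into_f_f[of id S, simplified])
  then show ?thesis
    by (simp add: differential_def)
qed

lemma smooth_on_cong: "open S \<Longrightarrow> (\<And>x. x \<in> S \<Longrightarrow> f x = g x) \<Longrightarrow> smooth_on S f \<longleftrightarrow> smooth_on S g"
  unfolding smooth_on_def using Ck_on_cong by blast

lemma inv_into_id: "x \<in> S \<Longrightarrow> inv_into S id x = x"
  using inv_into_f_f[of id S x] by simp

lemma spacetime_isothermal: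
  assumes "open S" "connected S" "S \<noteq> {}" "\<And>p. p \<in> S \<Longrightarrow> \<rho> p > 0" "smooth_on S \<rho>"
  shows "spacetime (isothermal_spacetime S \<rho>)"
proof -
  let ?M = "isothermal_spacetime S \<rho>"
  have "second_countable (euclidean :: (real^3) topology)"
  proof -
    obtain \<B> :: "(real^3) set set" where "countable \<B>" "\<And>C. C \<in> \<B> \<Longrightarrow> open C"
        "\<And>S. open S \<Longrightarrow> \<exists>\<U>. \<U> \<subseteq> \<B> \<and> S = \<Union>\<U>"
      using univ_second_countable by blast
    then show ?thesis
      unfolding second_countable_def by (intro exI[of _ \<B>]) (simp, blast)
  qed
  then have "second_countable (top_of_set S)"
    by (rule second_countable_subtopology)
  moreover have "smooth_on S (\<lambda>x. inv_into S id x)"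
    using smooth_on_cong[OF assms(1), of "inv_into S id" "\<lambda>x. x"] assms(1)
    by (auto simp: inv_into_id smooth_on_def Ck_on_linear bounded_linear_ident)
  moreover have "is_chart (top_of_set S) (S, id)"
    using assms(1) by (simp add: is_chart_def homeomorphic_map_id subtopology_subtopology)
  ultimately have "smooth_manifold ?M"
    by (simp add: smooth_manifold_def Hausdorff_space_subtopology comp_def)
  moreover have "lorentz_metric ?M"
  proof -
    have "smooth_on S (\<lambda>x. - (u $ 1) * v $ 1 + \<rho> (inv_into S id x) * (spatial u \<bullet> spatial v))" for u v
    proof -
      have "smooth_on S (\<lambda>x. - (u $ 1) * v $ 1 + \<rho> x * (spatial u \<bullet> spatial v))"
        using assms(1,5) unfolding smooth_on_def
        by (intro allI Ck_on_add Ck_on_const Ck_on_linear_comp[where L = "\<lambda>r. r * _"]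
            bounded_linear_mult_left) auto
      then show ?thesis
        using assms(1) by (subst smooth_on_cong) (auto simp: inv_into_id)
    qed
    moreover have "differential (S, id) (S, id) id p u = u" if "p \<in> S" for p and u :: "real^3"
      using differential_id[OF assms(1) that, of id S] differentiableI[OF has_derivative_id, of "at p"] by simp
    ultimately show ?thesis
      using lorentz_form_isothermal assms(4) by (simp add: lorentz_metric_def comp_def)
  qed
  moreover have "time_orienting ?M"
  proof -
    have "differential (S, id) (S, id) id p u = u" if "p \<in> S" for p and u :: "real^3"
      using differential_id[OF assms(1) that, of id S] differentiableI[OF has_derivative_id, of "at p"] by simp
    then show ?thesis
      by (simp add: time_orienting_def axis_def inner_complex_def)
  qed
  ultimately show ?thesis
    using assms(2,3) unfolding connectedin_iff_connected[symmetric] by (simp add: spacetime_def connectedin_def)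
qed

section \<open>Causal curves\<close>

lemma causal_curve_induct [consumes 1, case_names segment trans]:
  assumes "causal_curve M \<gamma> a b"
    and seg: "\<And>a b. causal_C1_segment M \<gamma> a b \<Longrightarrow> H a b"
    and trans: "\<And>a b c. H a b \<Longrightarrow> H b c \<Longrightarrow> H a c"
  shows "H a b"
proof -
  obtain n t where nt: "0 < (n::nat)" "t 0 = a" "t n = b"
      "\<And>i. i < n \<Longrightarrow> causal_C1_segment M \<gamma> (t i) (t (Suc i))"
    using assms(1) by (auto simp: causal_curve_def)
  have "H (t 0) (t (Suc k))" if "Suc k \<le> n" for k
    using that by (induction k) (use nt(4) seg trans in \<open>auto simp: Suc_le_eq\<close>)
  from this[of "n - 1"] show ?thesis
    using nt by simp
qed

lemma segment_imp_causal_relation: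
  assumes "causal_C1_segment M \<gamma> a b"
  shows "(\<gamma> a, \<gamma> b) \<in> causal_relation M"
proof -
  have "causal_curve M \<gamma> a b"
    unfolding causal_curve_def using assms
    by (intro exI[of _ 1] exI[of _ "\<lambda>i. if i = 0 then a else b"]) auto
  moreover have "\<gamma> s \<in> topspace (mtop M)" if "s \<in> {a..b}" for s
    using assms that by (auto simp: causal_C1_segment_def continuous_map_def)
  ultimately show ?thesis
    using assms unfolding causal_relation_def by (fastforce simp: causal_C1_segment_def)
qed

text \<open>With a single chart, being a causal segment is a statement about one velocity field \<open>w\<close> on the
  whole parameter interval.\<close>

lemma isothermal_segment_iff:
  assumes "\<forall>p\<in>S. \<rho> p > 0"
  shows "causal_C1_segment (isothermal_spacetime S \<rho>) \<gamma> a b \<longleftrightarrow>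
    a < b \<and> (\<exists>w. continuous_on {a..b} w \<and>
      (\<forall>s\<in>{a..b}. \<gamma> s \<in> S \<and> (\<gamma> has_vector_derivative w s) (at s within {a..b}) \<and>
         0 < w s $ 1 \<and> \<rho> (\<gamma> s) * (norm (spatial (w s)))\<^sup>2 \<le> (w s $ 1)\<^sup>2))"
    (is "?L \<longleftrightarrow> ?R")
proof
  assume L: ?L
  then have S: "\<gamma> s \<in> S" if "s \<in> {a..b}" for s
    using that by (auto simp: causal_C1_segment_def Pi_iff image_subset_iff)
  then have "{s \<in> {a..b}. \<gamma> s \<in> S} = {a..b}"
    by auto
  with L S show ?R
    using assms by (auto simp: causal_C1_segment_def future_directed_isothermal)
next
  assume R: ?R
  then have S: "\<gamma> s \<in> S" if "s \<in> {a..b}" for s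
    using that by auto
  then have "{s \<in> {a..b}. \<gamma> s \<in> S} = {a..b}"
    by auto
  moreover have "continuous_on {a..b} \<gamma>"
    using R by (meson continuous_on_vector_derivative)
  ultimately show ?L
    using assms R S by (auto simp: causal_C1_segment_def future_directed_isothermal)
qed

lemma isothermal_segment_time_increasing:
  assumes "causal_C1_segment (isothermal_spacetime S \<rho>) \<gamma> a b" "\<forall>p\<in>S. \<rho> p > 0"
  shows "\<gamma> a $ 1 < \<gamma> b $ 1"
proof -
  obtain w where "a < b"
      "\<forall>s\<in>{a..b}. (\<gamma> has_vector_derivative w s) (at s within {a..b}) \<and> 0 < w s $ 1"
    using assms(1) unfolding isothermal_segment_iff[OF assms(2)] by blast
  then have w: "a < b" "\<And>s. s \<in> {a..b} \<Longrightarrow> (\<gamma> has_vector_derivative w s) (at s within {a..b})"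
      "\<And>s. s \<in> {a..b} \<Longrightarrow> 0 < w s $ 1"
    by auto
  have "((\<lambda>s. \<gamma> s $ 1) has_derivative (\<lambda>h. h * w s $ 1)) (at s within {a..b})" if "a \<le> s" "s \<le> b" for s
    using has_vector_derivative_nth[OF w(2), of s 1] that by (simp add: has_vector_derivative_def)
  from mvt_simple[OF w(1) this] obtain s where "s \<in> {a<..<b}" "\<gamma> b $ 1 - \<gamma> a $ 1 = (b - a) * w s $ 1"
    by blast
  then show ?thesis
    using w by (smt (verit) atLeastAtMost_iff greaterThanLessThan_iff mult_pos_pos)
qed

lemma causal_isothermal:
  assumes "\<forall>p\<in>S. \<rho> p > 0"
  shows "causal (isothermal_spacetime S \<rho>)"
proof -
  have "\<gamma> a $ 1 < \<gamma> b $ 1" if "causal_curve (isothermal_spacetime S \<rho>) \<gamma> a b" for \<gamma> a b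
    using that by (induction rule: causal_curve_induct)
      (use isothermal_segment_time_increasing assms in \<open>fastforce+\<close>)
  then show ?thesis
    unfolding causal_def by (metis less_irrefl)
qed

lemma vector_derivative_bound:
  fixes Z :: "real \<Rightarrow> 'a::real_normed_vector"
  assumes "a \<le> b"
    and "\<And>s. s \<in> {a..b} \<Longrightarrow> (Z has_vector_derivative Z' s) (at s within {a..b})"
    and "\<And>s. s \<in> {a..b} \<Longrightarrow> (\<tau> has_vector_derivative \<tau>' s) (at s within {a..b})"
    and "\<And>s. s \<in> {a..b} \<Longrightarrow> norm (Z' s) \<le> \<tau>' s"
  shows "norm (Z b - Z a) \<le> \<tau> b - \<tau> a"
proof (cases "a = b")
  case False
  with assms(1) have "a < b" by simp
  then show ?thesis
  proof (rule differentiable_bound_general)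
    show "continuous_on {a..b} Z" "continuous_on {a..b} \<tau>"
      using assms(2,3) by (meson continuous_on_vector_derivative)+
    show "(Z has_vector_derivative Z' s) (at s)" "(\<tau> has_vector_derivative \<tau>' s) (at s)"
      if "a < s" "s < b" for s
      using assms(2,3)[of s] that by (simp_all add: at_within_Icc_at)
  qed (use assms(4) in auto)
qed simp

text \<open>The hypothesis says that \<open>(\<tau>, \<zeta>)\<close> is causal for \<open>-dt\<^sup>2 + exp (Re \<zeta>) |d\<zeta>|\<^sup>2 / 4\<close>. As
  \<open>d (exp (\<zeta> / 2)) = exp (\<zeta> / 2) d\<zeta> / 2\<close>, this metric is \<open>-dt\<^sup>2 + |dz|\<^sup>2\<close> in terms of
  \<open>z = exp (\<zeta> / 2)\<close>, so the speed of \<open>z\<close> is at most the speed of \<open>\<tau>\<close>.\<close>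

lemma square_root_bound:
  assumes "a \<le> b"
    and \<zeta>: "\<And>s. s \<in> {a..b} \<Longrightarrow> (\<zeta> has_vector_derivative \<zeta>' s) (at s within {a..b})"
    and \<tau>: "\<And>s. s \<in> {a..b} \<Longrightarrow> (\<tau> has_vector_derivative \<tau>' s) (at s within {a..b})"
    and "\<And>s. s \<in> {a..b} \<Longrightarrow> 0 < \<tau>' s"
    and "\<And>s. s \<in> {a..b} \<Longrightarrow> exp (Re (\<zeta> s)) / 4 * (norm (\<zeta>' s))\<^sup>2 \<le> (\<tau>' s)\<^sup>2"
  shows "norm (exp (\<zeta> b / 2) - exp (\<zeta> a / 2)) \<le> \<tau> b - \<tau> a"
proof (rule vector_derivative_bound[OF assms(1) _ \<tau>])
  fix s assume s: "s \<in> {a..b}"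
  have "((\<lambda>z. exp (z / 2)) has_field_derivative (exp (\<zeta> s / 2) / 2)) (at (\<zeta> s) within \<zeta> ` {a..b})"
    by (auto intro!: derivative_eq_intros)
  from field_vector_diff_chain_within[OF \<zeta>[OF s] this]
  show "((\<lambda>s. exp (\<zeta> s / 2)) has_vector_derivative \<zeta>' s * (exp (\<zeta> s / 2) / 2)) (at s within {a..b})"
    by (simp add: comp_def)
  have "(norm (\<zeta>' s * (exp (\<zeta> s / 2) / 2)))\<^sup>2 = exp (Re (\<zeta> s)) / 4 * (norm (\<zeta>' s))\<^sup>2"
    by (simp add: norm_mult norm_divide power_mult_distrib power_divide exp_double[symmetric])
  also have "\<dots> \<le> (\<tau>' s)\<^sup>2"
    by (rule assms(5)[OF s])
  finally show "norm (\<zeta>' s * (exp (\<zeta> s / 2) / 2)) \<le> \<tau>' s"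
    using assms(4)[OF s] by (meson less_imp_le power2_le_imp_le)
qed

text \<open>This lifts a path through the covering \<open>exp\<close> with control of the derivative: the primitive \<open>\<zeta>\<close> of
  \<open>w' / w\<close> makes \<open>exp (-\<zeta>) w\<close> constant.\<close>

lemma logarithm_along_path:
  assumes "\<And>s. s \<in> {a..b} \<Longrightarrow> (w has_vector_derivative w' s) (at s within {a..b})"
    and "continuous_on {a..b} w'" "\<And>s. s \<in> {a..b} \<Longrightarrow> w s \<noteq> (0::complex)"
  obtains \<zeta> where
    "\<And>s. s \<in> {a..b} \<Longrightarrow> (\<zeta> has_vector_derivative w' s / w s) (at s within {a..b})"
    "\<And>s. s \<in> {a..b} \<Longrightarrow> exp (\<zeta> s) = w s"
proof
  define \<zeta> where "\<zeta> s = Ln (w a) + integral {a..s} (\<lambda>s. w' s / w s)" for s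
  have "continuous_on {a..b} w"
    using assms(1) by (meson continuous_on_vector_derivative)
  then have "continuous_on {a..b} (\<lambda>s. w' s / w s)"
    using assms by (auto intro!: continuous_intros)
  then show \<zeta>: "(\<zeta> has_vector_derivative w' s / w s) (at s within {a..b})" if "s \<in> {a..b}" for s
    unfolding \<zeta>_def using integral_has_vector_derivative that
    by (auto intro!: derivative_eq_intros)
  have "((\<lambda>s. exp (- \<zeta> s) * w s) has_vector_derivative 0) (at s within {a..b})" if "s \<in> {a..b}" for s
  proof -
    have "((\<lambda>z. exp (- z)) has_field_derivative (- exp (- \<zeta> s))) (at (\<zeta> s) within \<zeta> ` {a..b})"
      by (auto intro!: derivative_eq_intros)
    from has_vector_derivative_mult[OF field_vector_diff_chain_within[OF \<zeta>[OF that] this] assms(1)[OF that]]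
    show ?thesis
      using assms(3)[OF that] by (simp add: comp_def)
  qed
  then obtain c where c: "\<And>s. s \<in> {a..b} \<Longrightarrow> exp (- \<zeta> s) * w s = c"
    using has_vector_derivative_zero_constant[of "{a..b}" "\<lambda>s. exp (- \<zeta> s) * w s"] by auto
  show "exp (\<zeta> s) = w s" if "s \<in> {a..b}" for s
  proof -
    have a: "a \<in> {a..b}"
      using that by auto
    then have "c = 1"
      using c[OF a] assms(3)[OF a] by (simp add: \<zeta>_def exp_minus)
    then show ?thesis
      using c[OF that] by (simp add: exp_minus field_simps)
  qed
qed

section \<open>The cone without its apex\<close>

definition punctured :: "(real^3) set" where
  "punctured = {p. spatial p \<noteq> 0}"

definition cone_spacetime :: "(real^3, real^3) lorentz_mfd" where
  "cone_spacetime = isothermal_spacetime punctured (\<lambda>p. inverse (4 * norm (spatial p)))"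

definition unrolled_spacetime :: "(real^3, real^3) lorentz_mfd" where
  "unrolled_spacetime = isothermal_spacetime UNIV (\<lambda>p. exp (p $ 2) / 4)"

definition cone_projection :: "real^3 \<Rightarrow> real^3" where
  "cone_projection p = event (p $ 1) (exp (spatial p))"

lemma spatial_event: "spatial (event t z) = z"
  by simp

lemma event_in_punctured [simp]: "event t z \<in> punctured \<longleftrightarrow> z \<noteq> 0"
  by (simp add: punctured_def)

lemma cone_projection_event [simp]: "cone_projection (event t z) = event t (exp z)"
  by (simp add: cone_projection_def)

lemma continuous_on_cone_projection: "continuous_on A cone_projection"
  unfolding cone_projection_def by (intro continuous_intros)

lemma cone_projection_image: "range cone_projection = punctured"
proof
  show "punctured \<subseteq> range cone_projection"
  proof
    fix p assume "p \<in> punctured"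
    then have "p = cone_projection (event (p $ 1) (Ln (spatial p)))"
      by (simp add: punctured_def)
    then show "p \<in> range cone_projection" by blast
  qed
qed (auto simp: cone_projection_def)

lemma open_punctured: "open punctured"
proof -
  have "open (spatial -` (- {0}))"
    by (intro open_vimage continuous_on_spatial continuous_on_id) auto
  then show ?thesis
    by (simp add: punctured_def vimage_def)
qed

lemma connected_punctured: "connected punctured"
  using connected_continuous_image[OF continuous_on_cone_projection connected_UNIV]
  by (simp add: cone_projection_image)

lemma punctured_pos: "\<forall>p\<in>punctured. inverse (4 * norm (spatial p)) > 0"
  by (simp add: punctured_def)

lemma topspace_cone: "topspace (mtop cone_spacetime) = punctured"
  by (simp add: cone_spacetime_def)

lemma spacetime_cone: "spacetime cone_spacetime"
proof -
  have "smooth_on punctured (\<lambda>p. inverse (4 * norm (spatial p)))"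
    unfolding smooth_on_def
    by (intro allI Ck_on_inverse Ck_on_linear_comp[OF open_punctured bounded_linear_mult_right]
        Ck_on_norm Ck_on_linear open_punctured bounded_linear_spatial) (auto simp: punctured_def)
  moreover have "punctured \<noteq> {}"
    unfolding cone_projection_image[symmetric] by simp
  ultimately show ?thesis
    unfolding cone_spacetime_def
    by (intro spacetime_isothermal[OF open_punctured connected_punctured _ bspec[OF punctured_pos]])
qed

lemma spacetime_unrolled: "spacetime unrolled_spacetime"
proof -
  have "smooth_on UNIV (\<lambda>p :: real^3. exp (p $ 2) / 4)"
    unfolding smooth_on_def divide_inverse
    by (intro allI Ck_on_linear_comp[OF open_UNIV bounded_linear_mult_left]
        Ck_on_exp Ck_on_linear open_UNIV bounded_linear_vec_nth)
  then show ?thesis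
    unfolding unrolled_spacetime_def by (intro spacetime_isothermal) auto
qed

lemma unrolled_segment_root_bound:
  assumes "causal_C1_segment unrolled_spacetime \<gamma> a b" "a \<le> s" "s \<le> s'" "s' \<le> b"
  shows "norm (exp (spatial (\<gamma> s') / 2) - exp (spatial (\<gamma> s) / 2)) \<le> \<gamma> s' $ 1 - \<gamma> s $ 1"
proof -
  obtain w where "\<forall>s\<in>{a..b}. \<gamma> s \<in> UNIV \<and> (\<gamma> has_vector_derivative w s) (at s within {a..b}) \<and>
      0 < w s $ 1 \<and> exp (\<gamma> s $ 2) / 4 * (norm (spatial (w s)))\<^sup>2 \<le> (w s $ 1)\<^sup>2"
    using assms(1) isothermal_segment_iff[of UNIV "\<lambda>p. exp (p $ 2) / 4" \<gamma> a b]
    by (auto simp: unrolled_spacetime_def)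
  then have w: "\<And>s. s \<in> {a..b} \<Longrightarrow> (\<gamma> has_vector_derivative w s) (at s within {a..b})"
      "\<And>s. s \<in> {a..b} \<Longrightarrow> 0 < w s $ 1"
      "\<And>s. s \<in> {a..b} \<Longrightarrow> exp (\<gamma> s $ 2) / 4 * (norm (spatial (w s)))\<^sup>2 \<le> (w s $ 1)\<^sup>2"
    by blast+
  have sub: "{s..s'} \<subseteq> {a..b}"
    using assms(2-4) by auto
  have d: "(\<gamma> has_vector_derivative w u) (at u within {s..s'})" if "u \<in> {s..s'}" for u
    using has_vector_derivative_within_subset[OF w(1) sub] that sub by blast
  show ?thesis
    by (rule square_root_bound[OF assms(3) has_vector_derivative_spatial[OF d] has_vector_derivative_nth[OF d]])
      (use w(2,3) sub in \<open>auto simp: subset_iff\<close>)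
qed

text \<open>On the cone, square roots are the flat coordinates, determined up to sign. The relation says that
  the distance on the cone is at most the elapsed time.\<close>

definition square_root_related :: "real^3 \<Rightarrow> real^3 \<Rightarrow> bool" where
  "square_root_related p q \<longleftrightarrow>
     (\<exists>z z'. z\<^sup>2 = spatial p \<and> z'\<^sup>2 = spatial q \<and> norm (z' - z) \<le> q $ 1 - p $ 1)"

text \<open>Two square roots of the same number agree up to sign, and changing the signs of both ends of
  the second segment preserves its length; so the segments can be joined.\<close>

lemma square_root_related_trans:
  assumes "square_root_related p q" "square_root_related q r"
  shows "square_root_related p r"
proof -
  obtain z1 z2 where 1: "z1\<^sup>2 = spatial p" "z2\<^sup>2 = spatial q" "norm (z2 - z1) \<le> q $ 1 - p $ 1"
    using assms(1) by (auto simp: square_root_related_def)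
  obtain z2' z3 where 2: "z2'\<^sup>2 = spatial q" "z3\<^sup>2 = spatial r" "norm (z3 - z2') \<le> r $ 1 - q $ 1"
    using assms(2) by (auto simp: square_root_related_def)
  have "z2' = z2 \<or> z2' = - z2"
    using 1 2 by (metis power2_eq_iff)
  then obtain z3' where "z3'\<^sup>2 = spatial r" "norm (z3' - z2) \<le> r $ 1 - q $ 1"
  proof
    assume "z2' = - z2"
    then show ?thesis
      using 2 that[of "- z3"] norm_minus_cancel[of "z3 + z2"] by simp
  qed (use 2 that in blast)
  with 1 show ?thesis
    unfolding square_root_related_def using norm_triangle_ineq[of "z3' - z2" "z2 - z1"]
    by (intro exI[of _ z1] exI[of _ z3']) simp
qed

lemma cone_segment_square_root_related:
  assumes "causal_C1_segment cone_spacetime \<gamma> a b"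
  shows "square_root_related (\<gamma> a) (\<gamma> b)"
proof -
  obtain w where "a < b" "continuous_on {a..b} w"
      "\<forall>s\<in>{a..b}. \<gamma> s \<in> punctured \<and> (\<gamma> has_vector_derivative w s) (at s within {a..b}) \<and> 0 < w s $ 1 \<and>
        inverse (4 * norm (spatial (\<gamma> s))) * (norm (spatial (w s)))\<^sup>2 \<le> (w s $ 1)\<^sup>2"
    using assms unfolding cone_spacetime_def isothermal_segment_iff[OF punctured_pos] by blast
  then have w: "a < b" "continuous_on {a..b} w" "\<And>s. s \<in> {a..b} \<Longrightarrow> \<gamma> s \<in> punctured"
      "\<And>s. s \<in> {a..b} \<Longrightarrow> (\<gamma> has_vector_derivative w s) (at s within {a..b})"
      "\<And>s. s \<in> {a..b} \<Longrightarrow> 0 < w s $ 1"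
      "\<And>s. s \<in> {a..b} \<Longrightarrow> inverse (4 * norm (spatial (\<gamma> s))) * (norm (spatial (w s)))\<^sup>2 \<le> (w s $ 1)\<^sup>2"
    by blast+
  have nz: "spatial (\<gamma> s) \<noteq> 0" if "s \<in> {a..b}" for s
    using w(3)[OF that] by (simp add: punctured_def)
  obtain \<zeta> where \<zeta>:
      "\<And>s. s \<in> {a..b} \<Longrightarrow> (\<zeta> has_vector_derivative spatial (w s) / spatial (\<gamma> s)) (at s within {a..b})"
      "\<And>s. s \<in> {a..b} \<Longrightarrow> exp (\<zeta> s) = spatial (\<gamma> s)"
    using logarithm_along_path[OF has_vector_derivative_spatial[OF w(4)] continuous_on_spatial[OF w(2)] nz]
    by metis
  have "norm (exp (\<zeta> b / 2) - exp (\<zeta> a / 2)) \<le> \<gamma> b $ 1 - \<gamma> a $ 1"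
  proof (rule square_root_bound[OF _ \<zeta>(1) has_vector_derivative_nth[OF w(4)] w(5)])
    fix s assume s: "s \<in> {a..b}"
    have "exp (Re (\<zeta> s)) = norm (spatial (\<gamma> s))"
      using \<zeta>(2)[OF s] norm_exp_eq_Re by metis
    then show "exp (Re (\<zeta> s)) / 4 * (norm (spatial (w s) / spatial (\<gamma> s)))\<^sup>2 \<le> (w s $ 1)\<^sup>2"
      using w(6)[OF s] nz[OF s] by (simp add: norm_divide power2_eq_square field_simps)
  qed (use w(1) in auto)
  moreover have "(exp (\<zeta> s / 2))\<^sup>2 = spatial (\<gamma> s)" if "s \<in> {a..b}" for s
    using \<zeta>(2)[OF that] by (simp add: exp_double[symmetric])
  ultimately show ?thesis
    unfolding square_root_related_def using w(1) by (intro exI[of _ "exp (\<zeta> a / 2)"] exI[of _ "exp (\<zeta> b / 2)"]) simp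
qed

lemma segment_avoids_origin:
  fixes z z' :: "'a::real_inner"
  assumes "z \<noteq> 0" "z' \<noteq> 0" "0 \<le> z \<bullet> z'" "0 \<le> s" "s \<le> 1"
  shows "z + s *\<^sub>R (z' - z) \<noteq> 0"
proof
  assume "z + s *\<^sub>R (z' - z) = 0"
  then have *: "(1 - s) *\<^sub>R z + s *\<^sub>R z' = 0"
    by (simp add: algebra_simps)
  have "(1 - s) * (z \<bullet> z) + s * (z \<bullet> z') = z \<bullet> ((1 - s) *\<^sub>R z + s *\<^sub>R z')"
    unfolding inner_add_right inner_scaleR_right ..
  then have "(1 - s) * (z \<bullet> z) + s * (z \<bullet> z') = 0"
    unfolding * by simp
  moreover have "0 \<le> (1 - s) * (z \<bullet> z)" "0 \<le> s * (z \<bullet> z')"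
    using assms by auto
  ultimately have "(1 - s) * (z \<bullet> z) = 0"
    by linarith
  then have "s = 1"
    using assms(1) by simp
  with * assms(2) show False by simp
qed

text \<open>Choosing the sign of the second root such that the inner product with the first one is nonnegative
  only shortens the segment and makes it avoid the origin. The freedom of sign reflects the cone
  angle \<open>\<pi>\<close>; on the universal cover there is no such choice.\<close>

lemma square_root_related_imp_causal_relation:
  assumes "p \<in> punctured" "q \<in> punctured" "square_root_related p q"
  shows "(p, q) \<in> causal_relation cone_spacetime"
proof (cases "p $ 1 = q $ 1")
  case True
  then have "p = q"
    using assms(3) by (auto simp: square_root_related_def intro: event_eqI)
  then show ?thesis
    using assms(1) by (simp add: causal_relation_def cone_spacetime_def)
next
  case False
  obtain z z1 where z1: "z\<^sup>2 = spatial p" "z1\<^sup>2 = spatial q" "norm (z1 - z) \<le> q $ 1 - p $ 1"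
    using assms(3) by (auto simp: square_root_related_def)
  obtain z' where z': "z'\<^sup>2 = spatial q" "norm (z' - z) \<le> q $ 1 - p $ 1" "0 \<le> z \<bullet> z'"
  proof (cases "0 \<le> z \<bullet> z1")
    case False
    then have "(norm (- z1 - z))\<^sup>2 \<le> (norm (z1 - z))\<^sup>2"
      by (simp add: power2_norm_eq_inner inner_diff_left inner_diff_right inner_commute)
    then have "norm (- z1 - z) \<le> norm (z1 - z)"
      by (meson norm_ge_zero power2_le_imp_le)
    then show ?thesis
      using that[of "- z1"] z1 False by simp
  qed (use z1 that in blast)
  define T where "T = q $ 1 - p $ 1"
  have "0 < T"
    unfolding T_def using False z'(2) norm_ge_zero[of "z' - z"] by linarith
  define Z where "Z s = z + s *\<^sub>R (z' - z)" for s :: real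
  have "z \<noteq> 0" "z' \<noteq> 0"
    using assms(1,2) z1(1) z'(1) by (auto simp: punctured_def)
  then have Z: "Z s \<noteq> 0" if "s \<in> {0..1}" for s
    unfolding Z_def using segment_avoids_origin z'(3) that by auto
  define \<gamma> where "\<gamma> s = event (p $ 1 + s * T) ((Z s)\<^sup>2)" for s
  define w where "w s = event T (2 * Z s * (z' - z))" for s
  have "(\<gamma> has_vector_derivative w s) (at s within {0..1})" for s
    unfolding \<gamma>_def[abs_def] w_def
  proof (rule has_vector_derivative_event)
    have Z': "(Z has_vector_derivative (z' - z)) (at s within {0..1})"
      unfolding Z_def[abs_def] by (auto intro!: derivative_eq_intros)
    show "((\<lambda>s. (Z s)\<^sup>2) has_vector_derivative 2 * Z s * (z' - z)) (at s within {0..1})"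
      using has_vector_derivative_mult[OF Z' Z'] by (simp add: power2_eq_square algebra_simps)
    show "((\<lambda>s. p $ 1 + s * T) has_vector_derivative T) (at s within {0..1})"
      by (auto intro!: derivative_eq_intros)
  qed
  moreover have "continuous_on {0..1} w"
    unfolding w_def Z_def by (intro continuous_intros)
  moreover have "inverse (4 * norm (spatial (\<gamma> s))) * (norm (spatial (w s)))\<^sup>2 \<le> (w s $ 1)\<^sup>2"
    if "s \<in> {0..1}" for s
  proof -
    have "inverse (4 * norm (spatial (\<gamma> s))) * (norm (spatial (w s)))\<^sup>2 = (norm (z' - z))\<^sup>2"
      using Z[OF that]
      by (simp add: \<gamma>_def w_def spatial_event norm_mult norm_power power_mult_distrib del: event_nth)
    also have "\<dots> \<le> T\<^sup>2"
      using z'(2) by (simp add: T_def power_mono)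
    finally show ?thesis
      by (simp add: w_def)
  qed
  ultimately have "causal_C1_segment cone_spacetime \<gamma> 0 1"
    unfolding cone_spacetime_def isothermal_segment_iff[OF punctured_pos]
    using \<open>0 < T\<close> Z by (intro conjI exI[of _ w]) (auto simp: \<gamma>_def w_def)
  moreover have "\<gamma> 0 = p" "\<gamma> 1 = q"
    by (rule event_eqI; simp add: \<gamma>_def T_def Z_def z1(1) z'(1))+
  ultimately show ?thesis
    using segment_imp_causal_relation by metis
qed

lemma causal_relation_cone:
  "causal_relation cone_spacetime =
    {(p, q). p \<in> punctured \<and> q \<in> punctured \<and> square_root_related p q}"
proof -
  have "square_root_related (\<gamma> a) (\<gamma> b)" if "causal_curve cone_spacetime \<gamma> a b" for \<gamma> a b
    using that by (induction rule: causal_curve_induct)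
      (use cone_segment_square_root_related square_root_related_trans in \<open>blast+\<close>)
  moreover have "square_root_related p p" for p
    unfolding square_root_related_def by (intro exI[of _ "csqrt (spatial p)"]) auto
  ultimately show ?thesis
    using square_root_related_imp_causal_relation
    unfolding causal_relation_def topspace_cone by fast
qed

text \<open>For roots \<open>z\<close>, \<open>z'\<close> put \<open>a = |z' - z|\<close> and \<open>b = |z' + z|\<close>. Although no continuous choice of roots
  exists, \<open>a\<^sup>2 + b\<^sup>2 = 2 (|w| + |w'|)\<close> and \<open>a b = |w - w'|\<close> are continuous in \<open>w = z\<^sup>2\<close> and
  \<open>w' = z'\<^sup>2\<close>. For \<open>T \<ge> 0\<close>, one of \<open>a\<close>, \<open>b\<close> is at most \<open>T\<close> iff \<open>T\<^sup>2\<close> is at least the mean of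
  \<open>a\<^sup>2\<close> and \<open>b\<^sup>2\<close> or \<open>(T\<^sup>2 - a\<^sup>2) (T\<^sup>2 - b\<^sup>2) \<le> 0\<close>.\<close>

lemma square_root_related_polynomial:
  defines "\<sigma> p q \<equiv> norm (spatial p) + norm (spatial q)"
  shows "square_root_related p q \<longleftrightarrow> 0 \<le> q $ 1 - p $ 1 \<and>
     (\<sigma> p q \<le> (q $ 1 - p $ 1)\<^sup>2 \<or>
      (q $ 1 - p $ 1)^4 + (norm (spatial p - spatial q))\<^sup>2 \<le> 2 * \<sigma> p q * (q $ 1 - p $ 1)\<^sup>2)"
proof -
  define T where "T = q $ 1 - p $ 1"
  define z z' where "z = csqrt (spatial p)" and "z' = csqrt (spatial q)"
  have z: "z\<^sup>2 = spatial p" "z'\<^sup>2 = spatial q"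
    by (simp_all add: z_def z'_def)
  define a b where "a = norm (z' - z)" and "b = norm (z' + z)"
  have rel: "square_root_related p q \<longleftrightarrow> a \<le> T \<or> b \<le> T"
  proof
    assume "square_root_related p q"
    then obtain u u' where u: "u\<^sup>2 = spatial p" "u'\<^sup>2 = spatial q" "norm (u' - u) \<le> T"
      by (auto simp: square_root_related_def T_def)
    have "u = z \<or> u = - z" "u' = z' \<or> u' = - z'"
      using u z by (metis power2_eq_iff)+
    then show "a \<le> T \<or> b \<le> T"
      using u(3) norm_minus_cancel[of "z' + z"] norm_minus_cancel[of "z' - z"] by (auto simp: a_def b_def)
  next
    assume "a \<le> T \<or> b \<le> T"
    then show "square_root_related p q"
    proof
      assume "b \<le> T"
      then show ?thesis
        unfolding square_root_related_def using z
        by (intro exI[of _ "- z"] exI[of _ z']) (simp add: b_def T_def)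
    next
      assume "a \<le> T"
      then show ?thesis
        unfolding square_root_related_def using z
        by (intro exI[of _ z] exI[of _ z']) (simp add: a_def T_def)
    qed
  qed
  have sum: "a\<^sup>2 + b\<^sup>2 = 2 * \<sigma> p q"
    unfolding \<sigma>_def z[symmetric] norm_power a_def b_def
    by (simp add: power2_norm_eq_inner inner_diff_left inner_diff_right inner_add_left inner_add_right)
  have "spatial p - spatial q = - ((z' - z) * (z' + z))"
    unfolding z[symmetric] by (simp add: power2_eq_square algebra_simps)
  then have prod: "(norm (spatial p - spatial q))\<^sup>2 = a\<^sup>2 * b\<^sup>2"
    by (simp add: norm_mult power_mult_distrib a_def b_def)
  have eq: "T^4 + (norm (spatial p - spatial q))\<^sup>2 \<le> 2 * \<sigma> p q * T\<^sup>2 \<longleftrightarrow> (T\<^sup>2 - a\<^sup>2) * (T\<^sup>2 - b\<^sup>2) \<le> 0"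
    unfolding prod sum[symmetric] by (simp add: algebra_simps power2_eq_square power4_eq_xxxx)
  have "0 \<le> a" "0 \<le> b"
    by (simp_all add: a_def b_def)
  have le: "x \<le> T \<longleftrightarrow> 0 \<le> T \<and> x\<^sup>2 \<le> T\<^sup>2" if "0 \<le> x" for x
    using that by (auto intro: power_mono power2_le_imp_le)
  have "a \<le> T \<or> b \<le> T \<longleftrightarrow> 0 \<le> T \<and> (a\<^sup>2 \<le> T\<^sup>2 \<or> b\<^sup>2 \<le> T\<^sup>2)"
    using le[OF \<open>0 \<le> a\<close>] le[OF \<open>0 \<le> b\<close>] by blast
  also have "a\<^sup>2 \<le> T\<^sup>2 \<or> b\<^sup>2 \<le> T\<^sup>2 \<longleftrightarrow> \<sigma> p q \<le> T\<^sup>2 \<or> (T\<^sup>2 - a\<^sup>2) * (T\<^sup>2 - b\<^sup>2) \<le> 0"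
    using sum unfolding mult_le_0_iff by linarith
  finally show ?thesis
    unfolding rel eq[symmetric] by (simp add: T_def)
qed

lemma causally_simple_cone: "causally_simple cone_spacetime"
proof -
  have "closed {(p, q). square_root_related p q}"
    unfolding square_root_related_polynomial case_prod_unfold
    by (intro closed_Collect_conj closed_Collect_disj closed_Collect_le continuous_intros)
  then have "closedin (top_of_set (punctured \<times> punctured)) (punctured \<times> punctured \<inter> {(p, q). square_root_related p q})"
    by (rule closedin_closed_Int)
  moreover have "causal_relation cone_spacetime = punctured \<times> punctured \<inter> {(p, q). square_root_related p q}"
    by (auto simp: causal_relation_cone)
  ultimately have "closed_causal_relation cone_spacetime"
    by (simp add: closed_causal_relation_def cone_spacetime_def)
  moreover have "causal cone_spacetime"
    unfolding cone_spacetime_def by (rule causal_isothermal) (rule punctured_pos)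
  ultimately show ?thesis
    by (simp add: causally_simple_def)
qed

section \<open>The universal covering\<close>

lemma has_derivative_cone_projection:
  "(cone_projection has_derivative (\<lambda>v. event (v $ 1) (exp (spatial p) * spatial v))) (at p)"
proof -
  have "(exp has_derivative (*) (exp (spatial p))) (at (spatial p))"
    using DERIV_exp by (rule has_field_derivative_imp_has_derivative)
  then have "((\<lambda>q. exp (spatial q)) has_derivative (\<lambda>v. exp (spatial p) * spatial v)) (at p)"
    by (rule has_derivative_compose[OF bounded_linear_imp_has_derivative[OF bounded_linear_spatial]])
  moreover have "((\<lambda>q. q $ 1) has_derivative (\<lambda>v. v $ 1)) (at p)"
    by (intro bounded_linear_imp_has_derivative bounded_linear_vec_nth)
  ultimately show ?thesis
    using bounded_linear.has_derivative[OF bounded_linear_event has_derivative_Pair[of "\<lambda>q. q $ 1"]]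
    unfolding cone_projection_def[abs_def] by simp
qed

lemma differential_cone_projection:
  "differential (UNIV, id) (punctured, id) cone_projection p v =
    event (v $ 1) (exp (spatial p) * spatial v)"
  using differential_id[of UNIV p cone_projection punctured]
    differentiableI[OF has_derivative_cone_projection[of p]]
    frechet_derivative_at[OF has_derivative_cone_projection[of p], symmetric]
  by simp

lemma inner_mult_left_complex: "(c * u) \<bullet> (c * v) = (norm c)\<^sup>2 * (u \<bullet> v)" for c u v :: complex
  unfolding cmod_power2 by (simp add: inner_complex_def power2_eq_square algebra_simps)

lemma Ck_on_cone_projection: "open S \<Longrightarrow> Ck_on k S cone_projection"
  unfolding cone_projection_def[abs_def]
  by (intro Ck_on_event Ck_on_exp Ck_on_linear bounded_linear_vec_nth bounded_linear_spatial)

definition branch :: "complex \<Rightarrow> real^3 \<Rightarrow> real^3" where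
  "branch a p = event (p $ 1) (a + Ln (spatial p / exp a))"

text \<open>The points whose spatial part is off the ray opposite to \<open>c\<close>; this is an evenly covered
  neighbourhood, with sheets \<open>slab a\<close> for \<open>exp a = c\<close> and local inverses \<open>branch a\<close>.\<close>

definition slit :: "complex \<Rightarrow> (real^3) set" where
  "slit c = {p. spatial p / c \<notin> \<real>\<^sub>\<le>\<^sub>0}"

definition slab :: "complex \<Rightarrow> (real^3) set" where
  "slab a = {p. \<bar>Im (spatial p - a)\<bar> < pi}"

lemma slit_subset: "slit c \<subseteq> punctured"
  by (auto simp: slit_def punctured_def)

lemma open_slit:
  assumes "c \<noteq> 0"
  shows "open (slit c)"
proof -
  have "open ((\<lambda>p. spatial p / c) -` (- \<real>\<^sub>\<le>\<^sub>0))"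
    using assms by (intro open_vimage continuous_intros) auto
  then show ?thesis
    by (simp add: slit_def vimage_def)
qed

lemma open_slab: "open (slab a)"
  unfolding slab_def by (intro open_Collect_less continuous_intros)

lemma exp_notin_nonpos_Reals:
  assumes "\<bar>Im z\<bar> < pi"
  shows "exp z \<notin> \<real>\<^sub>\<le>\<^sub>0"
proof
  assume "exp z \<in> \<real>\<^sub>\<le>\<^sub>0"
  then have "Im (exp z) = 0" "Re (exp z) \<le> 0"
    by (simp_all add: complex_nonpos_Reals_iff)
  moreover have "exp z \<noteq> 0"
    by simp
  ultimately have "Im (Ln (exp z)) = pi"
    unfolding Im_Ln_eq_pi[OF exp_not_eq_zero] by (simp add: less_le complex_eq_iff)
  moreover have "Ln (exp z) = z"
    using assms by (intro Ln_exp) auto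
  ultimately show False
    using assms by simp
qed

lemma cone_projection_branch:
  assumes "p \<in> slit (exp a)"
  shows "cone_projection (branch a p) = p"
proof -
  have "spatial p \<noteq> 0"
    using assms slit_subset by (auto simp: punctured_def)
  then show ?thesis
    by (simp add: branch_def exp_add)
qed

lemma branch_cone_projection: "p \<in> slab a \<Longrightarrow> branch a (cone_projection p) = p"
  by (simp add: branch_def slab_def cone_projection_def spatial_event exp_diff[symmetric] del: event_nth(2,3))

lemma branch_image: "p \<in> slit (exp a) \<Longrightarrow> branch a p \<in> slab a"
  using Im_Ln_less_pi[of "spatial p / exp a"] mpi_less_Im_Ln[of "spatial p / exp a"]
  by (cases "spatial p = 0") (auto simp: branch_def slab_def slit_def)

lemma cone_projection_slab: "p \<in> slab a \<Longrightarrow> cone_projection p \<in> slit (exp a)"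
  unfolding slit_def slab_def
  by (simp add: cone_projection_def spatial_event exp_diff[symmetric] exp_notin_nonpos_Reals del: event_nth(2,3))

lemma bij_betw_cone_projection: "bij_betw cone_projection (slab a) (slit (exp a))"
  by (rule bij_betw_byWitness[where f' = "branch a"])
    (auto simp: cone_projection_branch branch_cone_projection branch_image cone_projection_slab)

lemma inv_cone_projection: "p \<in> slit (exp a) \<Longrightarrow> inv_into (slab a) cone_projection p = branch a p"
  using bij_betw_cone_projection[of a]
  by (intro inv_into_f_eq) (auto simp: bij_betw_def branch_image cone_projection_branch)

lemma Ck_on_branch: "Ck_on k (slit (exp a)) (branch a)"
proof -
  have o: "open (slit (exp a))"
    by (intro open_slit) simp
  have "Ck_on k (slit (exp a)) (\<lambda>p. spatial p / exp a)"
    unfolding divide_inverse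
    by (intro Ck_on_linear_comp[OF o bounded_linear_mult_left] Ck_on_linear[OF o bounded_linear_spatial])
  then show ?thesis
    unfolding branch_def[abs_def]
    by (intro Ck_on_event[OF o] Ck_on_linear[OF o bounded_linear_vec_nth] Ck_on_add[OF o]
        Ck_on_const[OF o] Ck_on_Ln[OF o]) (auto simp: slit_def)
qed

lemma unrolled_simps [simp]:
  "mtop unrolled_spacetime = euclidean" "atlas unrolled_spacetime = {(UNIV, id)}"
  by (simp_all add: unrolled_spacetime_def)

lemma cone_simps [simp]:
  "mtop cone_spacetime = top_of_set punctured" "atlas cone_spacetime = {(punctured, id)}"
  by (simp_all add: cone_spacetime_def)

lemma smooth_covering_cone_projection:
  "smooth_covering unrolled_spacetime cone_projection cone_spacetime"
  unfolding smooth_covering_def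
proof (intro conjI ballI)
  have "cone_projection p \<in> punctured" for p
    using cone_projection_image by blast
  then show "smooth_map unrolled_spacetime (topspace (mtop unrolled_spacetime)) cone_spacetime cone_projection"
    by (auto simp: smooth_map_def smooth_on_def Ck_on_cone_projection continuous_on_cone_projection vimage_def
        continuous_map_in_subtopology)
next
  show "cone_projection ` topspace (mtop unrolled_spacetime) = topspace (mtop cone_spacetime)"
    by (simp add: cone_projection_image)
next
  fix p assume "p \<in> topspace (mtop cone_spacetime)"
  then have nz: "spatial p \<noteq> 0"
    by (simp add: punctured_def)
  define c where "c = spatial p"
  define \<V> where "\<V> = slab ` {a. exp a = c}"
  have "p \<in> slit c"
    using nz by (simp add: slit_def c_def)
  moreover have "openin (mtop cone_spacetime) (slit c)"
    using open_slit nz slit_subset open_punctured by (simp add: openin_open_eq c_def)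
  moreover have "disjoint \<V>"
  proof -
    have "slab a = slab b" if "exp a = c" "exp b = c" "p \<in> slab a" "p \<in> slab b" for a b p
    proof -
      have "\<bar>Im a - Im b\<bar> < 2 * pi"
        using that by (simp add: slab_def)
      then have "a = b"
        using exp_complex_eqI that by metis
      then show ?thesis by simp
    qed
    then show ?thesis
      unfolding pairwise_def disjnt_def \<V>_def by blast
  qed
  moreover have "\<Union>\<V> = {x \<in> topspace (mtop unrolled_spacetime). cone_projection x \<in> slit c}"
  proof -
    have "\<exists>a. exp a = c \<and> x \<in> slab a" if x: "cone_projection x \<in> slit c" for x
    proof (intro exI conjI)
      let ?l = "Ln (exp (spatial x) / c)"
      have l: "exp (spatial x) / c \<notin> \<real>\<^sub>\<le>\<^sub>0"
        using x by (simp add: slit_def cone_projection_def spatial_event del: event_nth)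
      show "exp (spatial x - ?l) = c"
        using nz by (simp add: exp_diff c_def)
      show "x \<in> slab (spatial x - ?l)"
        using Im_Ln_less_pi[OF l] mpi_less_Im_Ln[of "exp (spatial x) / c"] nz by (simp add: slab_def c_def)
    qed
    then show ?thesis
      using cone_projection_slab by (auto simp: \<V>_def)
  qed
  moreover have "openin (mtop unrolled_spacetime) V \<and> bij_betw cone_projection V (slit c) \<and>
      smooth_map cone_spacetime (slit c) unrolled_spacetime (inv_into V cone_projection)"
    if "V \<in> \<V>" for V
  proof -
    obtain a where a: "exp a = c" "V = slab a"
      using \<open>V \<in> \<V>\<close> by (auto simp: \<V>_def)
    have o: "open (slit c)"
      using open_slit nz by (simp add: c_def)
    have inv: "inv_into V cone_projection q = branch a q" if "q \<in> slit c" for q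
      using inv_cone_projection[of q a] that a by simp
    have eq: "(id \<circ> inv_into V cone_projection \<circ> inv_into punctured id) q = branch a q" if "q \<in> slit c" for q
      using inv_into_id[OF subsetD[OF slit_subset that]] inv[OF that] by simp
    have "Ck_on k (slit c) (id \<circ> inv_into V cone_projection \<circ> inv_into punctured id)" for k
      using iffD2[OF Ck_on_cong[OF o]] eq Ck_on_branch[of k a] a(1) by metis
    moreover have "continuous_on (slit c) (inv_into V cone_projection)"
      using Ck_on_branch[of 0 a] inv a by (simp cong: continuous_on_cong)
    moreover have "punctured \<inter> slit c = slit c"
      using slit_subset by blast
    ultimately have "smooth_map cone_spacetime (slit c) unrolled_spacetime (inv_into V cone_projection)"
      using \<open>openin (mtop cone_spacetime) (slit c)\<close>
      by (simp add: smooth_map_def smooth_on_def subtopology_subtopology)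
    then show ?thesis
      using open_slab[of a] bij_betw_cone_projection[of a] a by simp
  qed
  ultimately show "\<exists>U \<V>. p \<in> U \<and> openin (mtop cone_spacetime) U \<and> disjoint \<V> \<and>
      \<Union>\<V> = {x \<in> topspace (mtop unrolled_spacetime). cone_projection x \<in> U} \<and>
      (\<forall>V\<in>\<V>. openin (mtop unrolled_spacetime) V \<and> bij_betw cone_projection V U \<and>
        smooth_map cone_spacetime U unrolled_spacetime (inv_into V cone_projection))"
    by (intro exI[of _ "slit c"] exI[of _ \<V>]) blast
qed

lemma simply_connected_euclidean: "simply_connected_space (euclidean :: 'a::real_normed_vector topology)"
  unfolding simply_connected_space_def
proof (intro conjI allI impI)
  show "path_connected_space (euclidean :: 'a topology)"
    using path_connected_space_euclidean_subtopology[of "UNIV :: 'a set"] by simp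
next
  fix \<gamma> :: "real \<Rightarrow> 'a" and p assume \<gamma>: "pathin euclidean \<gamma> \<and> \<gamma> 0 = p \<and> \<gamma> 1 = p"
  then have "homotopic_paths UNIV \<gamma> (\<lambda>_. p)"
    by (intro homotopic_paths_linear) (auto simp: path_def pathin_def pathstart_def pathfinish_def)
  then show "homotopic_with (\<lambda>h. h 0 = p \<and> h 1 = p) (top_of_set {0..1}) euclidean \<gamma> (\<lambda>_. p)"
    using \<gamma> by (simp add: homotopic_paths_def pathstart_def pathfinish_def)
qed

lemma universal_covering_unrolled:
  "universal_covering_spacetime unrolled_spacetime cone_projection cone_spacetime"
  unfolding universal_covering_spacetime_def universal_covering_def
proof (intro conjI)
  show "smooth_manifold unrolled_spacetime"
    using spacetime_unrolled by (simp add: spacetime_def)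
  show "simply_connected_space (mtop unrolled_spacetime)"
    by (simp add: simply_connected_euclidean)
  have metric: "metric unrolled_spacetime c p u v =
      metric cone_spacetime d (cone_projection p)
        (event (u $ 1) (exp (spatial p) * spatial u)) (event (v $ 1) (exp (spatial p) * spatial v))"
    for c d p u v
    unfolding unrolled_spacetime_def cone_spacetime_def isothermal_spacetime_simps spatial_event
      inner_mult_left_complex cone_projection_def
    by (simp add: power2_eq_square)
  have norm: "inverse (4 * norm (exp (spatial p))) * (norm (exp (spatial p) * spatial v))\<^sup>2 =
      exp (p $ 2) / 4 * (norm (spatial v))\<^sup>2" for p v :: "real^3"
    by (simp add: norm_mult power2_eq_square)
  have "future_directed unrolled_spacetime c p v \<longleftrightarrow>
      future_directed cone_spacetime d (cone_projection p) (event (v $ 1) (exp (spatial p) * spatial v))"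
    for c d p v
  proof -
    have pos: "0 < exp (p $ 2) / 4" "0 < inverse (4 * norm (spatial (cone_projection p)))"
      by (simp_all add: cone_projection_def spatial_event del: event_nth)
    show ?thesis
      unfolding unrolled_spacetime_def cone_spacetime_def
        future_directed_isothermal[where \<rho> = "\<lambda>p. exp (p $ 2) / 4", OF pos(1)]
        future_directed_isothermal[where \<rho> = "\<lambda>p. inverse (4 * norm (spatial p))", OF pos(2)]
      unfolding event_nth(1) spatial_event cone_projection_def norm ..
  qed
  with metric show "\<forall>c\<in>atlas unrolled_spacetime. \<forall>d\<in>atlas cone_spacetime. \<forall>p\<in>dom c. cone_projection p \<in> dom d \<longrightarrow>
       (\<forall>u v. metric unrolled_spacetime c p u v = metric cone_spacetime d (cone_projection p)
           (differential c d cone_projection p u) (differential c d cone_projection p v)) \<and>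
       (\<forall>v. future_directed unrolled_spacetime c p v \<longleftrightarrow>
           future_directed cone_spacetime d (cone_projection p) (differential c d cone_projection p v))"
    by (simp add: differential_cone_projection)
qed (rule spacetime_unrolled smooth_covering_cone_projection)+

section \<open>Failure of closedness\<close>

text \<open>The chord from \<open>1\<close> to \<open>cis \<alpha>\<close> in the flat coordinate has length less than \<open>2\<close> and avoids the
  closed negative real axis, so the principal logarithm lifts it.\<close>

lemma unrolled_related_below_pi:
  assumes "0 < \<alpha>" "\<alpha> < pi"
  shows "(event 0 0, event 2 (Complex 0 (2 * \<alpha>))) \<in> causal_relation unrolled_spacetime"
proof -
  define e where "e = cis \<alpha>"
  define Z where "Z s = 1 + s *\<^sub>R (e - 1)" for s :: real
  have Z: "Z s \<notin> \<real>\<^sub>\<le>\<^sub>0" if "s \<in> {0..1}" for s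
  proof (cases "s = 0")
    case False
    then have "Im (Z s) > 0"
      using that assms by (simp add: Z_def e_def sin_gt_zero)
    then show ?thesis
      by (auto simp: complex_nonpos_Reals_iff)
  qed (simp add: Z_def)
  have nz: "Z s \<noteq> 0" if "s \<in> {0..1}" for s
    using Z[OF that] by auto
  define \<gamma> where "\<gamma> s = event (s * 2) (2 * Ln (Z s))" for s
  define w where "w s = event 2 (2 * ((e - 1) / Z s))" for s
  have "(\<gamma> has_vector_derivative w s) (at s within {0..1})" if s: "s \<in> {0..1}" for s
    unfolding \<gamma>_def[abs_def] w_def
  proof (rule has_vector_derivative_event)
    have Z': "(Z has_vector_derivative (e - 1)) (at s within {0..1})"
      unfolding Z_def[abs_def] by (auto intro!: derivative_eq_intros)
    have "((\<lambda>z. 2 * Ln z) has_field_derivative 2 / Z s) (at (Z s) within Z ` {0..1})"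
      using Z[OF s] by (auto intro!: derivative_eq_intros simp: field_simps)
    from field_vector_diff_chain_within[OF Z' this]
    show "((\<lambda>s. 2 * Ln (Z s)) has_vector_derivative 2 * ((e - 1) / Z s)) (at s within {0..1})"
      by (simp add: comp_def mult.commute)
    show "((\<lambda>s. s * 2) has_vector_derivative 2) (at s within {0..1})"
      by (auto intro!: derivative_eq_intros)
  qed
  moreover have "continuous_on {0..1} w"
    using nz unfolding w_def Z_def by (intro continuous_intros) auto
  moreover have "exp (\<gamma> s $ 2) / 4 * (norm (spatial (w s)))\<^sup>2 \<le> (w s $ 1)\<^sup>2" if "s \<in> {0..1}" for s
  proof -
    have "exp (\<gamma> s $ 2) = norm (exp (2 * Ln (Z s)))"
      unfolding norm_exp_eq_Re \<gamma>_def event_nth ..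
    also have "\<dots> = (norm (Z s))\<^sup>2"
      using nz[OF that] by (simp add: exp_double norm_power)
    finally have "exp (\<gamma> s $ 2) / 4 * (norm (spatial (w s)))\<^sup>2 = (norm (e - 1))\<^sup>2"
      using nz[OF that] unfolding w_def spatial_event
      by (simp add: norm_mult norm_divide power_mult_distrib power_divide
          del: right_diff_distrib_numeral)
    also have "\<dots> \<le> 2\<^sup>2"
      using norm_triangle_ineq4[of e 1] by (intro power_mono) (auto simp: e_def)
    finally show ?thesis
      by (simp add: w_def)
  qed
  ultimately have "causal_C1_segment unrolled_spacetime \<gamma> 0 1"
    unfolding unrolled_spacetime_def
    by (subst isothermal_segment_iff) (auto intro!: exI[of _ w] simp: w_def)
  moreover have "\<gamma> 0 = event 0 0"
    by (simp add: \<gamma>_def Z_def)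
  moreover have "Ln e = \<i> * \<alpha>"
    unfolding e_def cis_conv_exp using assms by (intro Ln_exp) auto
  then have "\<gamma> 1 = event 2 (Complex 0 (2 * \<alpha>))"
    by (simp add: \<gamma>_def Z_def complex_eq_iff event_def)
  ultimately show ?thesis
    using segment_imp_causal_relation by metis
qed

text \<open>In the flat coordinate the curve would run from \<open>1\<close> to \<open>-1\<close> within duration \<open>2\<close>. Where it crosses the
  imaginary axis, it does so off the origin, and the distances to \<open>1\<close> and \<open>-1\<close> both exceed \<open>1\<close>.\<close>

lemma unrolled_not_related_pi:
  "(event 0 0, event 2 (Complex 0 (2 * pi))) \<notin> causal_relation unrolled_spacetime"
proof
  define Z where "Z p = exp (spatial p / 2)" for p
  assume "(event 0 0, event 2 (Complex 0 (2 * pi))) \<in> causal_relation unrolled_spacetime"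
  moreover have "event 2 (Complex 0 (2 * pi)) \<noteq> event 0 0"
    by (metis event_nth(1) zero_neq_numeral)
  ultimately obtain \<gamma> a b where \<gamma>: "causal_curve unrolled_spacetime \<gamma> a b"
      "\<gamma> a = event 0 0" "\<gamma> b = event 2 (Complex 0 (2 * pi))"
    by (auto simp: causal_relation_def)
  have "a \<le> b \<and> continuous_on {a..b} \<gamma> \<and>
      (\<forall>s\<in>{a..b}. norm (Z (\<gamma> s) - Z (\<gamma> a)) \<le> \<gamma> s $ 1 - \<gamma> a $ 1 \<and>
        norm (Z (\<gamma> b) - Z (\<gamma> s)) \<le> \<gamma> b $ 1 - \<gamma> s $ 1)"
    using \<gamma>(1)
  proof (induction rule: causal_curve_induct)
    case (segment a b)
    then show ?case
      using unrolled_segment_root_bound[OF segment]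
      by (auto simp: Z_def causal_C1_segment_def)
  next
    case (trans a b c)
    have "continuous_on ({a..b} \<union> {b..c}) \<gamma>"
      using trans by (intro continuous_on_closed_Un) auto
    moreover have "{a..b} \<union> {b..c} = {a..c}"
      using trans by auto
    moreover have "norm (Z (\<gamma> b) - Z (\<gamma> a)) \<le> \<gamma> b $ 1 - \<gamma> a $ 1" "norm (Z (\<gamma> c) - Z (\<gamma> b)) \<le> \<gamma> c $ 1 - \<gamma> b $ 1"
      using trans by auto
    moreover have "norm (Z (\<gamma> s) - Z (\<gamma> a)) \<le> \<gamma> s $ 1 - \<gamma> a $ 1 \<and>
        norm (Z (\<gamma> c) - Z (\<gamma> s)) \<le> \<gamma> c $ 1 - \<gamma> s $ 1" if "s \<in> {a..c}" for s
    proof (cases "s \<le> b")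
      case True
      then have "norm (Z (\<gamma> s) - Z (\<gamma> a)) \<le> \<gamma> s $ 1 - \<gamma> a $ 1" "norm (Z (\<gamma> b) - Z (\<gamma> s)) \<le> \<gamma> b $ 1 - \<gamma> s $ 1"
        using trans that by auto
      then show ?thesis
        using \<open>norm (Z (\<gamma> c) - Z (\<gamma> b)) \<le> \<gamma> c $ 1 - \<gamma> b $ 1\<close>
          norm_triangle_ineq[of "Z (\<gamma> c) - Z (\<gamma> b)" "Z (\<gamma> b) - Z (\<gamma> s)"] by simp
    next
      case False
      then have "norm (Z (\<gamma> s) - Z (\<gamma> b)) \<le> \<gamma> s $ 1 - \<gamma> b $ 1" "norm (Z (\<gamma> c) - Z (\<gamma> s)) \<le> \<gamma> c $ 1 - \<gamma> s $ 1"
        using trans that by auto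
      then show ?thesis
        using \<open>norm (Z (\<gamma> b) - Z (\<gamma> a)) \<le> \<gamma> b $ 1 - \<gamma> a $ 1\<close>
          norm_triangle_ineq[of "Z (\<gamma> s) - Z (\<gamma> b)" "Z (\<gamma> b) - Z (\<gamma> a)"] by simp
    qed
    ultimately show ?case
      using trans by auto
  qed
  moreover have Zab: "Z (\<gamma> a) = 1" "Z (\<gamma> b) = -1"
  proof -
    show "Z (\<gamma> a) = 1"
      by (simp add: Z_def \<gamma> spatial_event del: event_nth)
    have "Complex 0 (2 * pi) / 2 = \<i> * pi"
      by (simp add: complex_eq_iff)
    then show "Z (\<gamma> b) = -1"
      by (simp add: Z_def \<gamma> spatial_event del: event_nth)
  qed
  moreover have "\<gamma> b $ 1 - \<gamma> a $ 1 = 2"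
    by (simp add: \<gamma>)
  ultimately have ab: "a \<le> b" "continuous_on {a..b} \<gamma>"
    and bound: "\<And>s. s \<in> {a..b} \<Longrightarrow> norm (Z (\<gamma> s) - 1) + norm (-1 - Z (\<gamma> s)) \<le> 2"
    by force+
  have "continuous_on {a..b} (\<lambda>s. Re (Z (\<gamma> s)))"
    unfolding Z_def using ab(2) by (intro continuous_intros) auto
  then obtain s where s: "s \<in> {a..b}" "Re (Z (\<gamma> s)) = 0"
    using IVT2'[of "\<lambda>s. Re (Z (\<gamma> s))" b 0 a] ab(1) Zab by auto
  moreover have "Z (\<gamma> s) \<noteq> 0"
    by (simp add: Z_def)
  ultimately have "1\<^sup>2 < (norm (Z (\<gamma> s) - 1))\<^sup>2" "1\<^sup>2 < (norm (-1 - Z (\<gamma> s)))\<^sup>2"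
    unfolding cmod_power2 by (simp_all add: complex_eq_iff)
  then have "1 < norm (Z (\<gamma> s) - 1)" "1 < norm (-1 - Z (\<gamma> s))"
    by (blast intro: power2_less_imp_less norm_ge_zero)+
  with bound[OF s(1)] show False
    by linarith
qed

lemma unrolled_not_closed:
  "\<not> closedin (prod_topology (mtop unrolled_spacetime) (mtop unrolled_spacetime))
     (causal_relation unrolled_spacetime)"
proof
  define f where "f \<alpha> = (event 0 0, event 2 (Complex 0 (2 * \<alpha>)))" for \<alpha>
  have f: "continuous_on UNIV f"
    unfolding f_def Complex_eq by (intro continuous_intros)
  assume "closedin (prod_topology (mtop unrolled_spacetime) (mtop unrolled_spacetime))
     (causal_relation unrolled_spacetime)"
  then have "closed (causal_relation unrolled_spacetime)"
    using prod_topology_subtopology_eu[of UNIV UNIV] by simp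
  then have "closed (f -` causal_relation unrolled_spacetime)"
    using f by (rule closed_vimage)
  moreover have "{0<..<pi} \<subseteq> f -` causal_relation unrolled_spacetime"
    using unrolled_related_below_pi by (auto simp: f_def)
  ultimately have "closure {0<..<pi} \<subseteq> f -` causal_relation unrolled_spacetime"
    by (intro closure_minimal)
  moreover have "pi \<in> closure {0<..<pi}"
    by (simp add: closure_greaterThanLessThan)
  ultimately have "pi \<in> f -` causal_relation unrolled_spacetime"
    by blast
  then show False
    using unrolled_not_related_pi by (simp add: f_def)
qed

theorem mainTheorem2:
  shows "\<exists>M :: (real^3, real^3) lorentz_mfd.
    spacetime M \<and> causally_simple M \<and>
    (\<exists>(N :: (real^3, real^3) lorentz_mfd) \<pi>.
       universal_covering_spacetime N \<pi> M \<and>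
       \<not> closedin (prod_topology (mtop N) (mtop N)) (causal_relation N) \<and>
       \<not> causally_simple N)"
  using spacetime_cone causally_simple_cone universal_covering_unrolled unrolled_not_closed
  unfolding causally_simple_def closed_causal_relation_def by blast

end
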